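(* Let $\mu$ be a $\sigma$-finite complex Borel measure on $\mathbb{C}_-$ such that $\int_{\mathbb{C}_-} |e^{tp}|\, d|\mu|(p) < \infty$ for all $t>0$, and let $h(t)=\int_{\mathbb{C}_-} e^{tp}\, d\mu(p)$ for $t>0$. Suppose that $w(t)=t^\alpha$ for $t>0$, with $\alpha>-1/2$. Then the weighted Hankel operator $\Gamma_{h,w}$ on $L^2(0,\infty)$ is Hilbert--Schmidt if and only if $$\int_0^\infty u^{4\alpha+1}|h(u)|^2\,du<\infty .$$ If $\mu\ge0$ is supported on $\mathbb{R}_-$, then this holds if and only if $$\int_{\mathbb{R}_-}\int_{\mathbb{R}_-}\frac{d\mu(x)\,d\mu(y)}{|x+y|^{4\alpha+2}}<\infty .$$
   Context: $\mathbb{C}_-=\{p\in\mathbb{C}:\operatorname{Re} p<0\}$ is the open left half-plane and $\mathbb{R}_-=(-\infty,0)$. The complex measure $\mu$ need not be finite: it is given by $d\mu=\theta\, d|\mu|$ with $|\mu|$ a $\sigma$-finite positive Borel measure on $\mathbb{C}_-$ and $\theta$ a measurable function with $|\theta|=1$. For measurable $w:(0,\infty)\to(0,\infty)$, the weighted Hankel operator $\Gamma_{h,w}$ is $$(\Gamma_{h,w}u)(t)=\int_0^\infty w(t)\,h(t+\tau)\,w(\tau)\,u(\tau)\,d\tau .$$ *)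

theory Defs
  imports "HOL-Analysis.Analysis"
begin

text \<open>Elements of \<open>L\<^sup>2(M)\<close> are represented by measurable, square integrable functions;
  equality in \<open>L\<^sup>2(M)\<close> is equality almost everywhere.\<close>

definition L2 :: "'a measure \<Rightarrow> ('a \<Rightarrow> complex) set" where
  "L2 M = {f. f \<in> borel_measurable M \<and> integrable M (\<lambda>x. (cmod (f x))\<^sup>2)}"

definition L2_inner :: "'a measure \<Rightarrow> ('a \<Rightarrow> complex) \<Rightarrow> ('a \<Rightarrow> complex) \<Rightarrow> complex" where
  "L2_inner M f g = (LINT x|M. f x * cnj (g x))"

definition L2_norm :: "'a measure \<Rightarrow> ('a \<Rightarrow> complex) \<Rightarrow> real" where
  "L2_norm M f = sqrt (LINT x|M. (cmod (f x))\<^sup>2)"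

text \<open>Bases are indexed by \<open>nat\<close>: this covers exactly the separable, infinite-dimensional
  spaces \<open>L\<^sup>2(M)\<close>, such as \<open>L\<^sup>2(0,\<infinity>)\<close>.\<close>

definition orthonormal_basis :: "'a measure \<Rightarrow> (nat \<Rightarrow> 'a \<Rightarrow> complex) \<Rightarrow> bool" where
  "orthonormal_basis M e \<longleftrightarrow>
     (\<forall>n. e n \<in> L2 M) \<and>
     (\<forall>m n. L2_inner M (e m) (e n) = (if m = n then 1 else 0)) \<and>
     (\<forall>f\<in>L2 M. \<forall>\<epsilon>>0. \<exists>N c. L2_norm M (\<lambda>x. f x - (\<Sum>n<N. c n * e n x)) < \<epsilon>)"

definition bounded_operator_L2 ::
  "'a measure \<Rightarrow> (('a \<Rightarrow> complex) \<Rightarrow> ('a \<Rightarrow> complex)) \<Rightarrow> bool" where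
  "bounded_operator_L2 M T \<longleftrightarrow>
     (\<forall>u\<in>L2 M. T u \<in> L2 M) \<and>
     (\<forall>u\<in>L2 M. \<forall>v\<in>L2 M. \<forall>a b.
        AE x in M. T (\<lambda>y. a * u y + b * v y) x = a * T u x + b * T v x) \<and>
     (\<exists>C. \<forall>u\<in>L2 M. L2_norm M (T u) \<le> C * L2_norm M u)"

definition hilbert_schmidt_L2 ::
  "'a measure \<Rightarrow> (('a \<Rightarrow> complex) \<Rightarrow> ('a \<Rightarrow> complex)) \<Rightarrow> bool" where
  "hilbert_schmidt_L2 M T \<longleftrightarrow>
     bounded_operator_L2 M T \<and>
     (\<exists>e. orthonormal_basis M e \<and> summable (\<lambda>n. (L2_norm M (T (e n)))\<^sup>2))"

abbreviation half_line :: "real measure" where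
  "half_line \<equiv> restrict_space lborel {0<..}"

definition weighted_hankel ::
  "(real \<Rightarrow> complex) \<Rightarrow> (real \<Rightarrow> real) \<Rightarrow> (real \<Rightarrow> complex) \<Rightarrow> real \<Rightarrow> complex" where
  "weighted_hankel h w u t =
     (LINT \<tau>|half_line. complex_of_real (w t) * h (t + \<tau>) * complex_of_real (w \<tau>) * u \<tau>)"

text \<open>The Bochner integral of a non-integrable function is \<open>0\<close> by convention, so convergence of
  the integral defining the operator has to be required separately.\<close>

definition weighted_hankel_defined :: "(real \<Rightarrow> complex) \<Rightarrow> (real \<Rightarrow> real) \<Rightarrow> bool" where
  "weighted_hankel_defined h w \<longleftrightarrow>
     (\<forall>u\<in>L2 half_line. AE t in half_line.
        integrable half_line
          (\<lambda>\<tau>. complex_of_real (w t) * h (t + \<tau>) * complex_of_real (w \<tau>) * u \<tau>))"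

definition weighted_hankel_hilbert_schmidt :: "(real \<Rightarrow> complex) \<Rightarrow> (real \<Rightarrow> real) \<Rightarrow> bool" where
  "weighted_hankel_hilbert_schmidt h w \<longleftrightarrow>
     weighted_hankel_defined h w \<and> hilbert_schmidt_L2 half_line (weighted_hankel h w)"

definition left_half_plane :: "complex set" where
  "left_half_plane = {p. Re p < 0}"

definition neg_reals :: "complex set" where
  "neg_reals = complex_of_real ` {..<0}"

text \<open>A \<open>\<sigma>\<close>-finite complex Borel measure \<open>\<mu>\<close> on the left half-plane, possibly of infinite total
  variation, is given by its polar decomposition \<open>d\<mu> = \<theta> dM\<close> with \<open>M = |\<mu>|\<close>.\<close>

definition polar_measure_on_left_half_plane ::
  "complex measure \<Rightarrow> (complex \<Rightarrow> complex) \<Rightarrow> bool" where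
  "polar_measure_on_left_half_plane M \<theta> \<longleftrightarrow>
     sigma_finite_measure M \<and>
     sets M = sets (restrict_space borel left_half_plane) \<and>
     \<theta> \<in> borel_measurable M \<and>
     (\<forall>p\<in>left_half_plane. cmod (\<theta> p) = 1)"

text \<open>Positivity of \<open>\<mu>\<close> means \<open>\<theta> = 1\<close> almost everywhere, and then \<open>\<mu> = M\<close>. Since the negative
  half-line is relatively closed in the left half-plane, \<open>\<mu>\<close> is supported on it iff \<open>M\<close>-almost
  every point lies in it.\<close>

definition positive_polar :: "complex measure \<Rightarrow> (complex \<Rightarrow> complex) \<Rightarrow> bool" where
  "positive_polar M \<theta> \<longleftrightarrow> (AE p in M. \<theta> p = 1)"

definition supported_on_neg_reals :: "complex measure \<Rightarrow> bool" where
  "supported_on_neg_reals M \<longleftrightarrow> (AE p in M. p \<in> neg_reals)"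

end

theory Submission
  imports Defs
begin

text \<open>The kernel of the operator is \<open>K(t, \<tau>) = w(t) h(t + \<tau>) w(\<tau>)\<close>. Substituting \<open>u = t + \<tau>\<close> turns
  \<open>\<integral>\<integral> |K|\<^sup>2\<close> into \<open>B(2\<alpha> + 1, 2\<alpha> + 1) \<integral> u\<^bsup>4\<alpha>+1\<^esup> |h(u)|\<^sup>2 du\<close>, so the first equivalence says that the
  operator is Hilbert--Schmidt iff \<open>K\<close> is square integrable. If it is, Bessel's inequality bounds
  \<open>\<Sum>n. \<parallel>T e\<^sub>n\<parallel>\<^sup>2\<close> for an orthonormal basis \<open>e\<close>, which is obtained from the exponentials
  \<open>e\<^bsup>-(n+1)x\<^esup>\<close> by Gram--Schmidt. Conversely, a Hilbert--Schmidt operator satisfies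
  \<open>|(T u)(t)|\<^sup>2 \<le> 2 \<parallel>u\<parallel>\<^sup>2 G(t)\<close> almost everywhere with \<open>G\<close> integrable; applied to truncations of
  \<open>cnj K(t, \<cdot>)\<close> this gives \<open>\<integral> |K(t, \<tau>)|\<^sup>2 d\<tau> \<le> 2 G(t)\<close>. For positive \<open>\<mu>\<close> on the negative reals,
  \<open>|h(u)|\<^sup>2 = \<integral>\<integral> e\<^bsup>u(x+y)\<^esup> d\<mu>(x) d\<mu>(y)\<close>, and integrating in \<open>u\<close> first produces the second condition
  up to the factor \<open>\<Gamma>(4\<alpha> + 2)\<close>.\<close>

section \<open>Square integrable functions\<close>


text \<open>The delicate direction is to recover the kernel from an abstract Hilbert--Schmidt
  operator. A pointwise bound on \<open>T u\<close> holds off a null set that depends on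
  \<open>u\<close>, while the natural test function, the conjugate section at t, changes with t:
  this would involve uncountably many null sets. Moreover the sections are not known in advance to
  be square integrable. The cut-off to compact intervals cures the second defect; the first is cured
  by continuity of \<open>h\<close> on the half-line, which is where the Laplace representation
  enters the first equivalence. A basis has to be constructed because being Hilbert--Schmidt is
  defined by the existence of one. The kernel computations use nonnegative extended integrals, so
  that Tonelli applies before anything is known to be finite; finiteness is then transferred through
  constants that are positive and finite. The bound \<alpha> > -1/2 makes both arguments of the Beta
  function and the argument 4\<alpha> + 2 of the Gamma function positive.\<close>

lemma cmod_add_sq_le: "(cmod (a + b))\<^sup>2 \<le> 2 * (cmod a)\<^sup>2 + 2 * (cmod b)\<^sup>2"
proof -
  have "(cmod (a + b))\<^sup>2 \<le> (cmod a + cmod b)\<^sup>2"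
    by (intro power_mono norm_triangle_ineq) auto
  also have "\<dots> \<le> 2 * (cmod a)\<^sup>2 + 2 * (cmod b)\<^sup>2"
    using zero_le_power2[of "cmod a - cmod b"] by (simp add: power2_eq_square algebra_simps)
  finally show ?thesis .
qed

lemma cmod_mult_le: "cmod (a * b) \<le> (cmod a)\<^sup>2 + (cmod b)\<^sup>2"
proof -
  have "2 * (cmod a * cmod b) \<le> (cmod a)\<^sup>2 + (cmod b)\<^sup>2"
    using zero_le_power2[of "cmod a - cmod b"] by (simp add: power2_eq_square algebra_simps)
  moreover have "0 \<le> cmod a * cmod b" by simp
  ultimately show ?thesis by (simp only: norm_mult)
qed

lemma L2_measurable [measurable_dest]: "f \<in> L2 M \<Longrightarrow> f \<in> borel_measurable M"
  by (simp add: L2_def)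

lemma L2_integrable: "f \<in> L2 M \<Longrightarrow> integrable M (\<lambda>x. (cmod (f x))\<^sup>2)"
  by (simp add: L2_def)

lemma L2_iff_nn_integral:
  assumes [measurable]: "f \<in> borel_measurable M"
  shows "f \<in> L2 M \<longleftrightarrow> (\<integral>\<^sup>+x. ennreal ((cmod (f x))\<^sup>2) \<partial>M) < \<infinity>"
  using assms by (simp add: L2_def integrable_iff_bounded)

lemma L2_nn_integral:
  "f \<in> L2 M \<Longrightarrow> (\<integral>\<^sup>+x. ennreal ((cmod (f x))\<^sup>2) \<partial>M) = ennreal (LINT x|M. (cmod (f x))\<^sup>2)"
  by (intro nn_integral_eq_integral L2_integrable) auto

lemma L2_norm_square: "(L2_norm M f)\<^sup>2 = (LINT x|M. (cmod (f x))\<^sup>2)"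
  by (simp add: L2_norm_def)

lemma L2_norm_nonneg: "0 \<le> L2_norm M f"
  by (simp add: L2_norm_def)

lemma L2_zero: "(\<lambda>x. 0) \<in> L2 M"
  by (simp add: L2_def)

lemma L2_add:
  assumes "f \<in> L2 M" "g \<in> L2 M"
  shows "(\<lambda>x. f x + g x) \<in> L2 M"
proof -
  note [measurable] = assms[THEN L2_measurable]
  have "integrable M (\<lambda>x. (cmod (f x + g x))\<^sup>2)"
    by (rule Bochner_Integration.integrable_bound
        [of _ "\<lambda>x. 2 * (cmod (f x))\<^sup>2 + 2 * (cmod (g x))\<^sup>2"])
      (use assms[THEN L2_integrable] cmod_add_sq_le in auto)
  then show ?thesis by (simp add: L2_def)
qed

lemma L2_scale:
  assumes "f \<in> L2 M"
  shows "(\<lambda>x. c * f x) \<in> L2 M"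
  using assms by (auto simp: L2_def norm_mult power_mult_distrib)

lemma L2_diff:
  assumes "f \<in> L2 M" "g \<in> L2 M"
  shows "(\<lambda>x. f x - g x) \<in> L2 M"
  using L2_add[OF assms(1) L2_scale[OF assms(2), of "-1"]] by simp

lemma borel_measurable_cnj [measurable (raw)]:
  "f \<in> borel_measurable M \<Longrightarrow> (\<lambda>x. cnj (f x)) \<in> borel_measurable M"
  by (rule borel_measurable_continuous_on[where f = cnj]) (auto intro: continuous_intros)

lemma L2_cnj: "f \<in> L2 M \<Longrightarrow> (\<lambda>x. cnj (f x)) \<in> L2 M"
  by (auto simp: L2_def)

lemma L2_sum:
  assumes "\<And>n. n \<in> A \<Longrightarrow> f n \<in> L2 M"
  shows "(\<lambda>x. \<Sum>n\<in>A. c n * f n x) \<in> L2 M"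
  using assms
  by (induction A rule: infinite_finite_induct) (auto intro!: L2_zero L2_add L2_scale)

lemma L2_mult_integrable:
  assumes "f \<in> L2 M" "g \<in> L2 M"
  shows "integrable M (\<lambda>x. f x * g x)"
proof -
  note [measurable] = assms[THEN L2_measurable]
  show ?thesis
    by (rule Bochner_Integration.integrable_bound
        [of _ "\<lambda>x. (cmod (f x))\<^sup>2 + (cmod (g x))\<^sup>2"])
      (use assms[THEN L2_integrable] cmod_mult_le in auto)
qed

lemma L2_inner_integrable:
  "f \<in> L2 M \<Longrightarrow> g \<in> L2 M \<Longrightarrow> integrable M (\<lambda>x. f x * cnj (g x))"
  by (intro L2_mult_integrable L2_cnj)

lemma L2_bound:
  assumes "g \<in> L2 M" "f \<in> borel_measurable M" "AE x in M. cmod (f x) \<le> cmod (g x)"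
  shows "f \<in> L2 M"
proof -
  note [measurable] = assms(2)
  have "integrable M (\<lambda>x. (cmod (f x))\<^sup>2)"
    by (rule Bochner_Integration.integrable_bound[OF L2_integrable[OF assms(1)]])
      (use assms(3) in \<open>auto intro: power_mono\<close>)
  then show ?thesis using assms by (simp add: L2_def)
qed

text \<open>Working with squared norms avoids square roots; the factor 2 is absorbed later by asking
  for errors below \<epsilon> / 4.\<close>

lemma L2_sq_norm_add_le:
  assumes "f \<in> L2 M" "g \<in> L2 M"
  shows "(LINT x|M. (cmod (f x + g x))\<^sup>2)
    \<le> 2 * (LINT x|M. (cmod (f x))\<^sup>2) + 2 * (LINT x|M. (cmod (g x))\<^sup>2)"
proof -
  have "(LINT x|M. (cmod (f x + g x))\<^sup>2) \<le> (LINT x|M. 2 * (cmod (f x))\<^sup>2 + 2 * (cmod (g x))\<^sup>2)"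
    using assms[THEN L2_integrable] L2_integrable[OF L2_add[OF assms]]
    by (intro integral_mono) (auto intro: cmod_add_sq_le)
  then show ?thesis using assms[THEN L2_integrable] by simp
qed

lemma L2_inner_sum_left:
  assumes "\<And>n. n \<in> A \<Longrightarrow> f n \<in> L2 M" "g \<in> L2 M"
  shows "L2_inner M (\<lambda>x. \<Sum>n\<in>A. c n * f n x) g = (\<Sum>n\<in>A. c n * L2_inner M (f n) g)"
proof -
  have "L2_inner M (\<lambda>x. \<Sum>n\<in>A. c n * f n x) g = (LINT x|M. (\<Sum>n\<in>A. c n * (f n x * cnj (g x))))"
    unfolding L2_inner_def by (simp add: sum_distrib_right mult.assoc)
  also have "\<dots> = (\<Sum>n\<in>A. LINT x|M. c n * (f n x * cnj (g x)))"
    using L2_inner_integrable[OF assms] by (intro Bochner_Integration.integral_sum) auto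
  finally show ?thesis by (simp add: L2_inner_def)
qed

lemma L2_inner_diff_left:
  assumes "f \<in> L2 M" "g \<in> L2 M" "k \<in> L2 M"
  shows "L2_inner M (\<lambda>x. f x - g x) k = L2_inner M f k - L2_inner M g k"
  using L2_inner_integrable[OF assms(1,3)] L2_inner_integrable[OF assms(2,3)]
  by (simp add: L2_inner_def left_diff_distrib)

lemma L2_inner_scale_left: "L2_inner M (\<lambda>x. c * f x) g = c * L2_inner M f g"
  by (simp add: L2_inner_def mult.assoc)

lemma L2_inner_cnj: "L2_inner M g f = cnj (L2_inner M f g)"
  unfolding L2_inner_def
  by (subst Bochner_Integration.integral_cnj[symmetric]) (simp add: mult.commute)

lemma L2_inner_self: "L2_inner M f f = complex_of_real (LINT x|M. (cmod (f x))\<^sup>2)"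
proof -
  have "f x * cnj (f x) = complex_of_real ((cmod (f x))\<^sup>2)" for x
    by (rule complex_norm_square[symmetric])
  then show ?thesis unfolding L2_inner_def by (simp only: integral_complex_of_real)
qed

text \<open>This expansion is the common source of Cauchy--Schwarz (with the optimal
  \<open>c\<close>) and of Bessel's inequality (with \<open>g\<close> a basis vector).\<close>

lemma L2_sq_norm_diff:
  assumes "f \<in> L2 M" "g \<in> L2 M"
  shows "(LINT x|M. (cmod (f x - c * g x))\<^sup>2) = (LINT x|M. (cmod (f x))\<^sup>2)
    - 2 * Re (cnj c * L2_inner M f g) + (cmod c)\<^sup>2 * (LINT x|M. (cmod (g x))\<^sup>2)"
proof -
  have eq: "(cmod (a - c * b))\<^sup>2 = (cmod a)\<^sup>2 - 2 * Re (cnj c * (a * cnj b)) + (cmod c)\<^sup>2 * (cmod b)\<^sup>2"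
    for a b
    by (simp add: cmod_power2 flip: power_mult_distrib norm_mult)
      (simp add: power2_eq_square algebra_simps)
  have i: "integrable M (\<lambda>x. cnj c * (f x * cnj (g x)))"
    using L2_inner_integrable[OF assms] by simp
  show ?thesis
    unfolding eq L2_inner_def
    using assms[THEN L2_integrable] integrable_Re[OF i] integral_Re[OF i]
    by (simp del: times_complex.sel)
qed

lemma L2_Cauchy_Schwarz:
  assumes "f \<in> L2 M" "g \<in> L2 M"
  shows "(cmod (L2_inner M f g))\<^sup>2 \<le> (LINT x|M. (cmod (f x))\<^sup>2) * (LINT x|M. (cmod (g x))\<^sup>2)"
proof (cases "(LINT x|M. (cmod (g x))\<^sup>2) = 0")
  case True
  then have "AE x in M. (cmod (g x))\<^sup>2 = 0"
    using integral_nonneg_eq_0_iff_AE[OF L2_integrable[OF assms(2)]] by auto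
  then have "L2_inner M f g = 0"
    unfolding L2_inner_def by (intro integral_eq_zero_AE) auto
  then show ?thesis by simp
next
  case False
  define b where "b = (LINT x|M. (cmod (g x))\<^sup>2)"
  define z where "z = L2_inner M f g"
  have b: "b > 0"
    using False Bochner_Integration.integral_nonneg[of M "\<lambda>x. (cmod (g x))\<^sup>2"] by (simp add: b_def less_le)
  \<comment> \<open>The multiple \<open>z / b\<close> of \<open>g\<close> is the orthogonal
    projection of \<open>f\<close>, the choice that minimises the squared norm.\<close>
  have "0 \<le> (LINT x|M. (cmod (f x - (z / b) * g x))\<^sup>2)"
    by (intro Bochner_Integration.integral_nonneg) auto
  also have "\<dots> = (LINT x|M. (cmod (f x))\<^sup>2) - 2 * Re (cnj (z / b) * z) + (cmod (z / b))\<^sup>2 * b"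
    unfolding L2_sq_norm_diff[OF assms] b_def z_def ..
  also have "cnj (z / b) * z = complex_of_real ((cmod z)\<^sup>2 / b)"
    using complex_norm_square[of z] by (simp add: mult.commute)
  also have "(cmod (z / b))\<^sup>2 * b = (cmod z)\<^sup>2 / b"
    using b by (simp add: norm_divide power_divide power2_eq_square)
  finally show ?thesis
    using b by (simp add: field_simps b_def[symmetric] z_def[symmetric])
qed

section \<open>Finite orthonormal expansions\<close>

context
  fixes M :: "'a measure" and e :: "nat \<Rightarrow> 'a \<Rightarrow> complex"
  assumes e_L2: "\<And>n. e n \<in> L2 M"
    and e_orth: "\<And>m n. L2_inner M (e m) (e n) = (if m = n then 1 else 0)"
begin

lemma orthonormal_sq_norm: "(LINT x|M. (cmod (e n x))\<^sup>2) = 1"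
  using e_orth[of n n] unfolding L2_inner_self by simp

text \<open>Pythagoras, one vector at a time: the part already subtracted is orthogonal to
  \<open>e N\<close>, so the residual has the same coefficient against \<open>e N\<close> as
  \<open>f\<close>, and removing it lowers the squared norm by the squared modulus of that
  coefficient.\<close>

lemma orthonormal_residual:
  assumes f: "f \<in> L2 M"
  shows "(LINT x|M. (cmod (f x - (\<Sum>n<N. L2_inner M f (e n) * e n x)))\<^sup>2)
    = (LINT x|M. (cmod (f x))\<^sup>2) - (\<Sum>n<N. (cmod (L2_inner M f (e n)))\<^sup>2)"
proof (induction N)
  case (Suc N)
  let ?s = "\<lambda>x. \<Sum>n<N. L2_inner M f (e n) * e n x"
  let ?c = "L2_inner M f (e N)"
  have s: "?s \<in> L2 M" by (intro L2_sum e_L2)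
  have "L2_inner M ?s (e N) = (\<Sum>n<N. L2_inner M f (e n) * L2_inner M (e n) (e N))"
    by (intro L2_inner_sum_left e_L2)
  also have "\<dots> = 0" by (intro sum.neutral) (auto simp: e_orth)
  finally have g: "L2_inner M (\<lambda>x. f x - ?s x) (e N) = ?c"
    by (subst L2_inner_diff_left[OF f s e_L2]) simp
  have "(LINT x|M. (cmod (f x - (\<Sum>n<Suc N. L2_inner M f (e n) * e n x)))\<^sup>2)
      = (LINT x|M. (cmod ((f x - ?s x) - ?c * e N x))\<^sup>2)"
    by (simp add: algebra_simps)
  also have "\<dots> = (LINT x|M. (cmod (f x - ?s x))\<^sup>2) - 2 * Re (cnj ?c * ?c) + (cmod ?c)\<^sup>2"
    by (subst L2_sq_norm_diff[OF L2_diff[OF f s] e_L2]) (simp add: orthonormal_sq_norm g)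
  also have "cnj ?c * ?c = complex_of_real ((cmod ?c)\<^sup>2)"
    using complex_norm_square[of ?c] by (simp add: mult.commute)
  finally show ?case by (simp add: Suc.IH)
qed simp

lemma Bessel:
  assumes "f \<in> L2 M"
  shows "(\<Sum>n<N. (cmod (L2_inner M f (e n)))\<^sup>2) \<le> (LINT x|M. (cmod (f x))\<^sup>2)"
proof -
  have "0 \<le> (LINT x|M. (cmod (f x - (\<Sum>n<N. L2_inner M f (e n) * e n x)))\<^sup>2)"
    by (intro Bochner_Integration.integral_nonneg) auto
  then show ?thesis unfolding orthonormal_residual[OF assms] by simp
qed

text \<open>The sum has Fourier coefficients \<open>c n\<close>, so it is its own partial expansion
  and the residual identity reads 0 on the left.\<close>

lemma orthonormal_sum_sq_norm:
  "(LINT x|M. (cmod (\<Sum>n<N. c n * e n x))\<^sup>2) = (\<Sum>n<N. (cmod (c n))\<^sup>2)"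
proof -
  let ?s = "\<lambda>x. \<Sum>n<N. c n * e n x"
  have s: "?s \<in> L2 M" by (intro L2_sum e_L2)
  have c: "L2_inner M ?s (e m) = c m" if "m < N" for m
  proof -
    have "L2_inner M ?s (e m) = (\<Sum>n<N. c n * L2_inner M (e n) (e m))"
      by (intro L2_inner_sum_left e_L2)
    also have "\<dots> = (\<Sum>n<N. if n = m then c n else 0)"
      by (intro sum.cong) (auto simp: e_orth)
    finally show ?thesis using that by simp
  qed
  have "0 = (LINT x|M. (cmod (?s x - (\<Sum>n<N. L2_inner M ?s (e n) * e n x)))\<^sup>2)"
    by (simp add: c)
  also have "\<dots> = (LINT x|M. (cmod (?s x))\<^sup>2) - (\<Sum>n<N. (cmod (c n))\<^sup>2)"
    by (subst orthonormal_residual[OF s]) (simp add: c)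
  finally show ?thesis by simp
qed

end


section \<open>Hilbert--Schmidt operators\<close>

lemma integral_operator_sq_le:
  assumes k: "k \<in> L2 M" and u: "u \<in> L2 M"
  shows "(cmod (LINT y|M. k y * u y))\<^sup>2 \<le> (LINT y|M. (cmod (k y))\<^sup>2) * (LINT y|M. (cmod (u y))\<^sup>2)"
  using L2_Cauchy_Schwarz[OF k L2_cnj[OF u]] by (simp add: L2_inner_def)

text \<open>Almost every section is in L^2, so Cauchy--Schwarz gives convergence and boundedness
  with constant \<open>sqrt B\<close>, where \<open>B\<close> is the double integral of the squared
  kernel. The same \<open>B\<close> bounds the Hilbert--Schmidt sum.\<close>

lemma kernel_L2_hilbert_schmidt:
  fixes K :: "'a \<Rightarrow> 'a \<Rightarrow> complex"
  assumes M: "sigma_finite_measure M"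
    and K [measurable]: "case_prod K \<in> borel_measurable (M \<Otimes>\<^sub>M M)"
    and fin: "(\<integral>\<^sup>+t. \<integral>\<^sup>+\<tau>. ennreal ((cmod (K t \<tau>))\<^sup>2) \<partial>M \<partial>M) < \<infinity>"
    and e: "orthonormal_basis M e"
  shows "\<forall>u\<in>L2 M. AE t in M. integrable M (\<lambda>\<tau>. K t \<tau> * u \<tau>)"
    and "hilbert_schmidt_L2 M (\<lambda>u t. LINT \<tau>|M. K t \<tau> * u \<tau>)"
proof -
  interpret sigma_finite_measure M by fact
  define T where "T = (\<lambda>u t. LINT \<tau>|M. K t \<tau> * u \<tau>)"
  define k2 where "k2 t = (\<integral>\<^sup>+\<tau>. ennreal ((cmod (K t \<tau>))\<^sup>2) \<partial>M)" for t
  have k2_meas [measurable]: "k2 \<in> borel_measurable M"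
    unfolding k2_def by measurable
  have k2_fin: "(\<integral>\<^sup>+t. k2 t \<partial>M) < \<infinity>" using fin by (simp add: k2_def)
  define B where "B = enn2real (\<integral>\<^sup>+t. k2 t \<partial>M)"
  have B: "(\<integral>\<^sup>+t. k2 t \<partial>M) = ennreal B" "0 \<le> B"
    using k2_fin by (simp_all add: B_def less_top)
  have AE_L2: "AE t in M. K t \<in> L2 M \<and> k2 t = ennreal (LINT \<tau>|M. (cmod (K t \<tau>))\<^sup>2)"
  proof -
    have "AE t in M. k2 t \<noteq> \<infinity>"
      using k2_fin by (intro nn_integral_noteq_infinite) auto
    then show ?thesis
    proof (rule AE_mp, intro AE_I2 impI)
      fix t assume t: "t \<in> space M" and "k2 t \<noteq> \<infinity>"
      moreover have [measurable]: "K t \<in> borel_measurable M" using t by measurable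
      ultimately have "K t \<in> L2 M"
        by (simp add: L2_iff_nn_integral k2_def top.not_eq_extremum)
      then show "K t \<in> L2 M \<and> k2 t = ennreal (LINT \<tau>|M. (cmod (K t \<tau>))\<^sup>2)"
        by (simp add: k2_def L2_nn_integral)
    qed
  qed
  show defd: "\<forall>u\<in>L2 M. AE t in M. integrable M (\<lambda>\<tau>. K t \<tau> * u \<tau>)"
  proof
    fix u assume "u \<in> L2 M"
    with AE_L2 show "AE t in M. integrable M (\<lambda>\<tau>. K t \<tau> * u \<tau>)"
      by (auto elim!: eventually_mono intro: L2_mult_integrable)
  qed
  have T_meas [measurable]: "T u \<in> borel_measurable M" if "u \<in> L2 M" for u
  proof -
    note [measurable] = L2_measurable[OF that]
    show ?thesis unfolding T_def by measurable
  qed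
  have T_bound: "(\<integral>\<^sup>+t. ennreal ((cmod (T u t))\<^sup>2) \<partial>M) \<le> ennreal (B * (LINT x|M. (cmod (u x))\<^sup>2))"
    if u: "u \<in> L2 M" for u
  proof -
    let ?n = "LINT x|M. (cmod (u x))\<^sup>2"
    have "(\<integral>\<^sup>+t. ennreal ((cmod (T u t))\<^sup>2) \<partial>M) \<le> (\<integral>\<^sup>+t. k2 t * ennreal ?n \<partial>M)"
    proof (rule nn_integral_mono_AE, use AE_L2 in eventually_elim)
      case (elim t)
      then show ?case
        using integral_operator_sq_le[of "K t" M u] u
        by (simp add: T_def flip: ennreal_mult)
    qed
    also have "\<dots> = ennreal (B * ?n)"
      by (subst nn_integral_multc) (auto simp: B ennreal_mult)
    finally show ?thesis .
  qed
  have T_L2: "T u \<in> L2 M" if "u \<in> L2 M" for u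
    using T_bound[OF that] that
    by (subst L2_iff_nn_integral) (auto intro: le_less_trans ennreal_less_top)
  have bdd: "bounded_operator_L2 M T"
    unfolding bounded_operator_L2_def
  proof (intro conjI ballI allI)
    fix u v a b assume uv: "u \<in> L2 M" "v \<in> L2 M"
    \<comment> \<open>Additivity of the integral needs both integrals to converge, which is known
      only for almost every t.\<close>
    have "AE t in M. integrable M (\<lambda>\<tau>. K t \<tau> * u \<tau>)" "AE t in M. integrable M (\<lambda>\<tau>. K t \<tau> * v \<tau>)"
      using defd uv by auto
    then show "AE t in M. T (\<lambda>y. a * u y + b * v y) t = a * T u t + b * T v t"
    proof eventually_elim
      case (elim t)
      have "T (\<lambda>y. a * u y + b * v y) t
          = (LINT \<tau>|M. a * (K t \<tau> * u \<tau>) + b * (K t \<tau> * v \<tau>))"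
        by (simp add: T_def algebra_simps)
      also have "\<dots> = a * T u t + b * T v t" using elim by (simp add: T_def)
      finally show ?case .
    qed
  next
    show "\<exists>C. \<forall>u\<in>L2 M. L2_norm M (T u) \<le> C * L2_norm M u"
    proof (intro exI ballI)
      fix u assume u: "u \<in> L2 M"
      have "ennreal (LINT x|M. (cmod (T u x))\<^sup>2) \<le> ennreal (B * (LINT x|M. (cmod (u x))\<^sup>2))"
        using T_bound[OF u] L2_nn_integral[OF T_L2[OF u]] by simp
      then have "(LINT x|M. (cmod (T u x))\<^sup>2) \<le> B * (LINT x|M. (cmod (u x))\<^sup>2)"
        using B(2) by (subst (asm) ennreal_le_iff) auto
      then show "L2_norm M (T u) \<le> sqrt B * L2_norm M u"
        by (simp add: L2_norm_def flip: real_sqrt_mult)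
    qed
  qed (rule T_L2)
  have eL2: "e n \<in> L2 M" and orth: "L2_inner M (e m) (e n) = (if m = n then 1 else 0)" for m n
    using e by (auto simp: orthonormal_basis_def)
  have "(\<Sum>n<N. (L2_norm M (T (e n)))\<^sup>2) \<le> B" for N
  proof -
    have "ennreal (\<Sum>n<N. (L2_norm M (T (e n)))\<^sup>2) = (\<Sum>n<N. \<integral>\<^sup>+t. ennreal ((cmod (T (e n) t))\<^sup>2) \<partial>M)"
      using L2_nn_integral[OF T_L2[OF eL2]] by (simp add: L2_norm_square flip: sum_ennreal)
    also have "\<dots> = (\<integral>\<^sup>+t. (\<Sum>n<N. ennreal ((cmod (T (e n) t))\<^sup>2)) \<partial>M)"
      using eL2 by (intro nn_integral_sum[symmetric]) measurable
    also have "\<dots> \<le> (\<integral>\<^sup>+t. k2 t \<partial>M)"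
    proof (rule nn_integral_mono_AE, use AE_L2 in eventually_elim)
      case (elim t)
      then have K: "(\<lambda>x. cnj (K t x)) \<in> L2 M" by (auto intro: L2_cnj)
      \<comment> \<open>For fixed t the values \<open>T (e n) t\<close> are, up to conjugation, the
        Fourier coefficients of the conjugate section, so Bessel applies pointwise in t before
        integrating.\<close>
      have "L2_inner M (\<lambda>x. cnj (K t x)) (e n) = cnj (T (e n) t)" for n
        unfolding L2_inner_def T_def by (subst Bochner_Integration.integral_cnj[symmetric]) simp
      then have "(\<Sum>n<N. (cmod (T (e n) t))\<^sup>2) \<le> (LINT x|M. (cmod (K t x))\<^sup>2)"
        using Bessel[of e M, OF eL2 orth K, of N] by simp
      then show ?case using elim by (simp add: sum_ennreal ennreal_leI)
    qed
    finally show ?thesis using B by simp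
  qed
  then have "summable (\<lambda>n. (L2_norm M (T (e n)))\<^sup>2)"
    by (intro summableI_nonneg_bounded[of _ B]) auto
  then have "hilbert_schmidt_L2 M T"
    using bdd e by (auto simp: hilbert_schmidt_L2_def)
  then show "hilbert_schmidt_L2 M (\<lambda>u t. LINT \<tau>|M. K t \<tau> * u \<tau>)" by (simp add: T_def)
qed

section \<open>A pointwise majorant for Hilbert--Schmidt operators\<close>

lemma bounded_operator_L2_linear:
  assumes "bounded_operator_L2 M T" "u \<in> L2 M" "v \<in> L2 M"
  shows "AE x in M. T (\<lambda>y. a * u y + b * v y) x = a * T u x + b * T v x"
  using assms by (simp add: bounded_operator_L2_def)

lemma bounded_operator_L2_sum:
  assumes T: "bounded_operator_L2 M T" and e: "\<And>n. e n \<in> L2 M"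
  shows "AE t in M. T (\<lambda>x. \<Sum>n<N. c n * e n x) t = (\<Sum>n<(N::nat). c n * T (e n) t)"
proof (induction N)
  case 0
  \<comment> \<open>That \<open>T\<close> sends the zero function to 0 almost everywhere is obtained
    from linearity with zero coefficients.\<close>
  have "AE t in M. T (\<lambda>y. 0 * e 0 y + 0 * e 0 y) t = 0 * T (e 0) t + 0 * T (e 0) t"
    by (intro bounded_operator_L2_linear T e)
  then show ?case by simp
next
  case (Suc N)
  have "AE t in M. T (\<lambda>y. 1 * (\<Sum>n<N. c n * e n y) + c N * e N y) t
      = 1 * T (\<lambda>y. \<Sum>n<N. c n * e n y) t + c N * T (e N) t"
    by (intro bounded_operator_L2_linear T e L2_sum)
  with Suc show ?case by eventually_elim simp
qed

text \<open>Summable squared norms make the series of squared moduli integrable, hence finite almost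
  everywhere, so its terms tend to 0. No subsequence has to be chosen.\<close>

lemma AE_tendsto_0_of_sq_norm_le:
  assumes d: "\<And>k. d k \<in> L2 M" and le: "\<And>k. (LINT x|M. (cmod (d k x))\<^sup>2) \<le> b k"
    and b: "summable b"
  shows "AE x in M. (\<lambda>k. d k x) \<longlonglongrightarrow> 0"
proof -
  note [measurable] = d[THEN L2_measurable]
  have b0: "0 \<le> b k" for k
    by (rule order_trans[OF Bochner_Integration.integral_nonneg le]) simp
  have "(\<integral>\<^sup>+x. (\<Sum>k. ennreal ((cmod (d k x))\<^sup>2)) \<partial>M)
      = (\<Sum>k. ennreal (LINT x|M. (cmod (d k x))\<^sup>2))"
    by (subst nn_integral_suminf) (auto simp: L2_nn_integral[OF d])
  also have "\<dots> \<le> (\<Sum>k. ennreal (b k))"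
    by (intro suminf_le ennreal_leI le) auto
  also have "\<dots> < \<infinity>"
    using ennreal_suminf_neq_top[OF b b0] by (simp add: top.not_eq_extremum)
  finally have "AE x in M. (\<Sum>k. ennreal ((cmod (d k x))\<^sup>2)) \<noteq> \<infinity>"
    by (intro nn_integral_noteq_infinite) auto
  then show ?thesis
  proof eventually_elim
    case (elim x)
    then have "summable (\<lambda>k. (cmod (d k x))\<^sup>2)"
      by (intro summable_suminf_not_top) auto
    then have "(\<lambda>k. (cmod (d k x))\<^sup>2) \<longlonglongrightarrow> 0" by (rule summable_LIMSEQ_zero)
    then have "(\<lambda>k. sqrt ((cmod (d k x))\<^sup>2)) \<longlonglongrightarrow> sqrt 0" by (intro tendsto_real_sqrt)
    then show ?case by (simp add: tendsto_norm_zero_iff)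
  qed
qed

text \<open>The majorant is \<open>G t = (\<Sum>n. |(T e\<^sub>n)(t)|\<^sup>2)\<close>; the crude constant 2 spares the triangle
  inequality in \<open>L\<^sup>2\<close>.\<close>

lemma hilbert_schmidt_pointwise_bound:
  assumes "hilbert_schmidt_L2 M T"
  obtains G :: "'a \<Rightarrow> ennreal" where "G \<in> borel_measurable M" "(\<integral>\<^sup>+t. G t \<partial>M) < \<infinity>"
    "\<And>u. u \<in> L2 M \<Longrightarrow>
       AE t in M. ennreal ((cmod (T u t))\<^sup>2) \<le> ennreal (2 * (LINT x|M. (cmod (u x))\<^sup>2)) * G t"
proof -
  from assms obtain e where T: "bounded_operator_L2 M T" and e: "orthonormal_basis M e"
    and sm: "summable (\<lambda>n. (L2_norm M (T (e n)))\<^sup>2)"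
    unfolding hilbert_schmidt_L2_def by blast
  have eL2: "e n \<in> L2 M" and orth: "L2_inner M (e m) (e n) = (if m = n then 1 else 0)" for m n
    using e by (auto simp: orthonormal_basis_def)
  have TL2: "T u \<in> L2 M" if "u \<in> L2 M" for u
    using T that by (auto simp: bounded_operator_L2_def)
  have "\<exists>C. \<forall>u\<in>L2 M. L2_norm M (T u) \<le> C * L2_norm M u"
    using T unfolding bounded_operator_L2_def by (elim conjE)
  then obtain C0 where C0: "\<forall>u\<in>L2 M. L2_norm M (T u) \<le> C0 * L2_norm M u" ..
  note [measurable] = TL2[OF eL2, THEN L2_measurable]
  define G where "G t = (\<Sum>n. ennreal ((cmod (T (e n) t))\<^sup>2))" for t
  have G_meas [measurable]: "G \<in> borel_measurable M" unfolding G_def by measurable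
  have "(\<integral>\<^sup>+t. G t \<partial>M) = (\<Sum>n. \<integral>\<^sup>+t. ennreal ((cmod (T (e n) t))\<^sup>2) \<partial>M)"
    unfolding G_def by (intro nn_integral_suminf) measurable
  also have "\<dots> = (\<Sum>n. ennreal ((L2_norm M (T (e n)))\<^sup>2))"
    unfolding L2_norm_square L2_nn_integral[OF TL2[OF eL2]] ..
  also have "\<dots> \<noteq> \<infinity>"
    unfolding infinity_ennreal_def by (rule ennreal_suminf_neq_top[OF sm]) simp
  finally have G_fin: "(\<integral>\<^sup>+t. G t \<partial>M) < \<infinity>"
    unfolding infinity_ennreal_def top.not_eq_extremum .
  have G_AE: "AE t in M. G t \<noteq> \<infinity>"
    using G_fin by (intro nn_integral_noteq_infinite) auto
  have "AE t in M. ennreal ((cmod (T u t))\<^sup>2) \<le> ennreal (2 * (LINT x|M. (cmod (u x))\<^sup>2)) * G t"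
    if u: "u \<in> L2 M" for u
  proof -
    define n where "n = (LINT x|M. (cmod (u x))\<^sup>2)"
    have "\<forall>\<epsilon>>0. \<exists>N c. L2_norm M (\<lambda>x. u x - (\<Sum>n<N. c n * e n x)) < \<epsilon>"
      using e u by (simp add: orthonormal_basis_def)
    \<comment> \<open>The geometric rate makes the squared errors summable, which gives almost
      everywhere convergence of \<open>T (s k)\<close> to \<open>T u\<close> below.\<close>
    then have "\<forall>k::nat. \<exists>N c. L2_norm M (\<lambda>x. u x - (\<Sum>n<N. c n * e n x)) < (1/2)^k"
      by simp
    then obtain N c where Nc: "\<forall>k::nat. L2_norm M (\<lambda>x. u x - (\<Sum>n<N k. c k n * e n x)) < (1/2)^k"
      unfolding choice_iff by (elim exE)
    define s where "s k x = (\<Sum>n<N k. c k n * e n x)" for k x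
    have s: "s k \<in> L2 M" for k unfolding s_def by (intro L2_sum eL2)
    have us: "(LINT x|M. (cmod (u x - s k x))\<^sup>2) \<le> (1/4)^k" for k
    proof -
      have "(L2_norm M (\<lambda>x. u x - s k x))\<^sup>2 \<le> ((1/2)^k)\<^sup>2"
        using Nc[rule_format, of k] by (intro power_mono L2_norm_nonneg) (auto simp: s_def)
      also have "\<dots> = (1/4)^k" by (simp add: power2_eq_square flip: power_mult_distrib)
      finally show ?thesis by (simp add: L2_norm_square)
    qed
    have lin: "AE t in M. T (\<lambda>y. u y - s k y) t = T u t - T (s k) t" for k
    proof -
      have "AE t in M. T (\<lambda>y. 1 * u y + (-1) * s k y) t = 1 * T u t + (-1) * T (s k) t"
        by (intro bounded_operator_L2_linear T u s)
      then show ?thesis by simp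
    qed
    have "AE t in M. (\<lambda>k. T (\<lambda>y. u y - s k y) t) \<longlonglongrightarrow> 0"
    proof (rule AE_tendsto_0_of_sq_norm_le)
      show "T (\<lambda>y. u y - s k y) \<in> L2 M" for k by (intro TL2 L2_diff u s)
      show "summable (\<lambda>k. C0\<^sup>2 * (1/4::real)^k)" by (intro summable_mult summable_geometric) auto
      fix k
      have us': "(\<lambda>y. u y - s k y) \<in> L2 M" by (intro L2_diff u s)
      have "(L2_norm M (T (\<lambda>y. u y - s k y)))\<^sup>2 \<le> (C0 * L2_norm M (\<lambda>y. u y - s k y))\<^sup>2"
        using bspec[OF C0 us'] by (intro power_mono L2_norm_nonneg) auto
      also have "\<dots> \<le> C0\<^sup>2 * (1/4)^k"
        using us[of k] by (auto simp: power_mult_distrib L2_norm_square intro: mult_left_mono)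
      finally show "(LINT x|M. (cmod (T (\<lambda>y. u y - s k y) x))\<^sup>2) \<le> C0\<^sup>2 * (1/4)^k"
        by (simp add: L2_norm_square)
    qed
    moreover have "AE t in M. \<forall>k. T (\<lambda>y. u y - s k y) t = T u t - T (s k) t"
      using lin by (simp add: AE_all_countable)
    moreover have "AE t in M. \<forall>k. T (s k) t = (\<Sum>n<N k. c k n * T (e n) t)"
      unfolding AE_all_countable s_def by (intro allI bounded_operator_L2_sum T eL2)
    ultimately show ?thesis using G_AE
    proof eventually_elim
      case (elim t)
      define g where "g = enn2real (G t)"
      have g: "G t = ennreal g" "0 \<le> g" using elim by (auto simp: g_def top.not_eq_extremum)
      have gs: "(\<Sum>n<K. (cmod (T (e n) t))\<^sup>2) \<le> g" for K
      proof -
        have "(\<Sum>n<K. ennreal ((cmod (T (e n) t))\<^sup>2)) \<le> G t"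
          unfolding G_def by (intro sum_le_suminf summableI) auto
        then have "ennreal (\<Sum>n<K. (cmod (T (e n) t))\<^sup>2) \<le> G t"
          by (subst sum_ennreal[symmetric]) auto
        then show ?thesis using g by simp
      qed
      \<comment> \<open>Cauchy--Schwarz separates the coefficients, whose square sum is the squared
        norm of \<open>s k\<close>, from a partial sum of \<open>G t\<close>. Writing
        \<open>s k\<close> as \<open>u\<close> minus the error bounds that norm, and the error term
        vanishes in the limit.\<close>
      have bnd: "(cmod (T (s k) t))\<^sup>2 \<le> (2 * n + 2 * (1/4)^k) * g" for k
      proof -
        have "(cmod (T (s k) t))\<^sup>2 \<le> (\<Sum>n<N k. cmod (c k n) * cmod (T (e n) t))\<^sup>2"
          using elim by (auto simp flip: norm_mult intro!: power_mono norm_sum)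
        also have "\<dots> \<le> (\<Sum>n<N k. (cmod (c k n))\<^sup>2) * (\<Sum>n<N k. (cmod (T (e n) t))\<^sup>2)"
          by (rule Cauchy_Schwarz_ineq_sum)
        also have "\<dots> \<le> (\<Sum>n<N k. (cmod (c k n))\<^sup>2) * g"
          by (intro mult_left_mono gs sum_nonneg) auto
        also have "(\<Sum>n<N k. (cmod (c k n))\<^sup>2) = (LINT x|M. (cmod (s k x))\<^sup>2)"
          unfolding s_def by (rule orthonormal_sum_sq_norm[symmetric]) (use eL2 orth in auto)
        also have "\<dots> = (LINT x|M. (cmod (u x + (-1) * (u x - s k x)))\<^sup>2)" by simp
        also have "\<dots> \<le> 2 * n + 2 * (LINT x|M. (cmod ((-1) * (u x - s k x)))\<^sup>2)"
          unfolding n_def by (rule L2_sq_norm_add_le[OF u L2_scale[OF L2_diff[OF u s]]])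
        also have "\<dots> \<le> 2 * n + 2 * (1/4)^k"
          using us[of k] by (simp add: norm_minus_commute)
        finally show ?thesis using g by (simp add: mult_right_mono)
      qed
      have "(\<lambda>k. T u t - T (\<lambda>y. u y - s k y) t) \<longlonglongrightarrow> T u t - 0"
        using elim by (intro tendsto_intros) auto
      then have "(\<lambda>k. T (s k) t) \<longlonglongrightarrow> T u t" using elim by simp
      then have 1: "(\<lambda>k. (cmod (T (s k) t))\<^sup>2) \<longlonglongrightarrow> (cmod (T u t))\<^sup>2" by (intro tendsto_intros)
      have "(\<lambda>k. (1/4::real)^k) \<longlonglongrightarrow> 0" by (intro LIMSEQ_realpow_zero) auto
      then have 2: "(\<lambda>k. (2 * n + 2 * (1/4)^k) * g) \<longlonglongrightarrow> (2 * n + 2 * 0) * g"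
        by (intro tendsto_mult tendsto_add tendsto_const)
      have "(cmod (T u t))\<^sup>2 \<le> (2 * n + 2 * 0) * g"
        using bnd by (intro LIMSEQ_le[OF 1 2]) auto
      moreover have "0 \<le> n" by (simp add: n_def)
      ultimately show ?case using g by (simp add: n_def[symmetric] flip: ennreal_mult)
    qed
  qed
  with G_meas G_fin show ?thesis by (rule that)
qed


section \<open>Orthonormal bases\<close>

text \<open>Since \<open>inverse 0 = 0\<close>, a residual of norm zero would yield the zero
  function; linear independence excludes this later. The equation has no base case, so as a
  simplification rule it would unfold forever.\<close>

fun gram_schmidt :: "'a measure \<Rightarrow> (nat \<Rightarrow> 'a \<Rightarrow> complex) \<Rightarrow> nat \<Rightarrow> 'a \<Rightarrow> complex" where
  "gram_schmidt M f N =
     (let r = (\<lambda>x. f N x - (\<Sum>n<N. L2_inner M (f N) (gram_schmidt M f n) * gram_schmidt M f n x))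
      in (\<lambda>x. inverse (complex_of_real (L2_norm M r)) * r x))"

declare gram_schmidt.simps [simp del]

text \<open>Orthonormalisation preserves the span of every initial segment, so density carries over
  to the new system.\<close>

lemma orthonormal_basis_exists:
  fixes f :: "nat \<Rightarrow> 'a \<Rightarrow> complex"
  assumes f: "\<And>n. f n \<in> L2 M"
    and indep: "\<And>N c. (LINT x|M. (cmod (f N x - (\<Sum>n<N. c n * f n x)))\<^sup>2) \<noteq> 0"
    and dense: "\<And>g \<epsilon>. g \<in> L2 M \<Longrightarrow> \<epsilon> > 0 \<Longrightarrow>
      \<exists>N c. (LINT x|M. (cmod (g x - (\<Sum>n<N. c n * f n x)))\<^sup>2) < \<epsilon>"
  shows "\<exists>e. orthonormal_basis M e"
proof -
  define e where "e = gram_schmidt M f"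
  define r where "r N x = f N x - (\<Sum>n<N. L2_inner M (f N) (e n) * e n x)" for N x
  have e_eq: "e N x = inverse (complex_of_real (L2_norm M (r N))) * r N x" for N x
    unfolding e_def r_def by (subst gram_schmidt.simps) (simp add: Let_def)
  \<comment> \<open>This direction turns the residual \<open>r N\<close> into \<open>f N\<close>
    minus a combination of earlier \<open>f n\<close>, the form in which \<open>indep\<close> shows
    that its norm is nonzero.\<close>
  have span_ef: "\<exists>d. \<forall>x. (\<Sum>n<N. c n * e n x) = (\<Sum>n<N. d n * f n x)" for N c
  proof (induction N arbitrary: c)
    case (Suc N)
    \<comment> \<open>The coefficient of \<open>f N\<close> once \<open>e N\<close> is unfolded; the
      remainder of \<open>r N\<close> is merged into the coefficients of the earlier
      \<open>e n\<close>, to which the induction hypothesis applies.\<close>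
    define b where "b = c N * inverse (complex_of_real (L2_norm M (r N)))"
    obtain d where d: "\<And>x. (\<Sum>n<N. (c n - b * L2_inner M (f N) (e n)) * e n x) = (\<Sum>n<N. d n * f n x)"
      using Suc[of "\<lambda>n. c n - b * L2_inner M (f N) (e n)"] by blast
    have "(\<Sum>n<Suc N. c n * e n x) = (\<Sum>n<Suc N. (d(N := b)) n * f n x)" for x
    proof -
      have "(\<Sum>n<Suc N. c n * e n x) = (\<Sum>n<N. c n * e n x) + b * r N x"
        by (simp add: e_eq b_def)
      also have "\<dots> = (\<Sum>n<N. (c n - b * L2_inner M (f N) (e n)) * e n x) + b * f N x"
        by (simp add: r_def algebra_simps sum_subtractf sum_distrib_left)
      finally show ?thesis by (simp add: d)
    qed
    then show ?case by blast
  qed simp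
  have r_nz: "L2_norm M (r N) \<noteq> 0" for N
  proof -
    obtain d where "\<And>x. (\<Sum>n<N. L2_inner M (f N) (e n) * e n x) = (\<Sum>n<N. d n * f n x)"
      using span_ef[where N = N and c = "\<lambda>n. L2_inner M (f N) (e n)"] by blast
    then have "r N = (\<lambda>x. f N x - (\<Sum>n<N. d n * f n x))" by (simp add: r_def fun_eq_iff)
    then show ?thesis using indep[of N d] by (simp add: L2_norm_def)
  qed
  \<comment> \<open>The reverse direction solves for \<open>f N\<close>, using that the norm of
    \<open>r N\<close> is nonzero, and serves to transfer density.\<close>
  have span_fe: "\<exists>d. \<forall>x. (\<Sum>n<N. c n * f n x) = (\<Sum>n<N. d n * e n x)" for N c
  proof (induction N arbitrary: c)
    case (Suc N)
    obtain d where d: "\<And>x. (\<Sum>n<N. c n * f n x) = (\<Sum>n<N. d n * e n x)"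
      using Suc by blast
    define d' where "d' n = (if n < N then d n + c N * L2_inner M (f N) (e n)
      else c N * complex_of_real (L2_norm M (r N)))" for n
    have "(\<Sum>n<Suc N. c n * f n x) = (\<Sum>n<Suc N. d' n * e n x)" for x
    proof -
      have "r N x = complex_of_real (L2_norm M (r N)) * e N x"
        using r_nz[of N] by (simp add: e_eq)
      then have "f N x = complex_of_real (L2_norm M (r N)) * e N x + (\<Sum>n<N. L2_inner M (f N) (e n) * e n x)"
        by (simp add: r_def diff_eq_eq)
      then have "(\<Sum>n<Suc N. c n * f n x) = (\<Sum>n<N. d n * e n x)
          + (c N * complex_of_real (L2_norm M (r N)) * e N x + c N * (\<Sum>n<N. L2_inner M (f N) (e n) * e n x))"
        by (simp add: d algebra_simps)
      also have "\<dots> = (\<Sum>n<Suc N. d' n * e n x)"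
        by (simp add: d'_def sum.distrib sum_distrib_left algebra_simps)
      finally show ?thesis .
    qed
    then show ?case by blast
  qed simp
  have main: "e N \<in> L2 M \<and> (\<forall>m<N. L2_inner M (e N) (e m) = 0) \<and> L2_inner M (e N) (e N) = 1" for N
  proof (induction N rule: less_induct)
    case (less N)
    have rL2: "r N \<in> L2 M"
      unfolding r_def using less by (intro L2_diff f L2_sum) auto
    have eN: "e N = (\<lambda>x. inverse (complex_of_real (L2_norm M (r N))) * r N x)"
      by (simp add: e_eq fun_eq_iff)
    then have eL2: "e N \<in> L2 M" using L2_scale[OF rL2] by simp
    have "L2_inner M (r N) (e m) = 0" if m: "m < N" for m
    proof -
      have em: "e m \<in> L2 M" using less m by auto
      have o: "L2_inner M (e n) (e m) = (if n = m then 1 else 0)" if "n < N" for n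
      proof (cases n m rule: linorder_cases)
        \<comment> \<open>The induction hypothesis for \<open>m\<close> has the later vector on the
          left; conjugate symmetry gives the order needed here.\<close>
        case less' : less
        then show ?thesis using less m L2_inner_cnj[of M "e n" "e m"] by auto
      qed (use less that in auto)
      have "L2_inner M (r N) (e m) = L2_inner M (f N) (e m)
          - L2_inner M (\<lambda>x. \<Sum>n<N. L2_inner M (f N) (e n) * e n x) (e m)"
        unfolding r_def using less em by (intro L2_inner_diff_left f L2_sum) auto
      also have "L2_inner M (\<lambda>x. \<Sum>n<N. L2_inner M (f N) (e n) * e n x) (e m)
          = (\<Sum>n<N. L2_inner M (f N) (e n) * L2_inner M (e n) (e m))"
        using less em by (intro L2_inner_sum_left) auto
      also have "\<dots> = (\<Sum>n<N. if n = m then L2_inner M (f N) (e n) else 0)"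
        by (intro sum.cong) (auto simp: o)
      finally show ?thesis using m by simp
    qed
    then have "\<forall>m<N. L2_inner M (e N) (e m) = 0"
      by (simp add: eN L2_inner_scale_left)
    moreover have "L2_inner M (e N) (e N) = 1"
    proof -
      have "(LINT x|M. (cmod (e N x))\<^sup>2) = (LINT x|M. inverse (L2_norm M (r N)) ^ 2 * (cmod (r N x))\<^sup>2)"
        by (simp add: eN norm_mult power_mult_distrib norm_inverse L2_norm_nonneg power_inverse)
      also have "\<dots> = inverse (L2_norm M (r N)) ^ 2 * (L2_norm M (r N))\<^sup>2"
        by (simp add: L2_norm_square)
      also have "\<dots> = 1" using r_nz[of N] by (simp add: field_simps)
      finally show ?thesis by (simp add: L2_inner_self)
    qed
    ultimately show ?case using eL2 by blast
  qed
  have "orthonormal_basis M e"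
    unfolding orthonormal_basis_def
  proof (intro conjI allI ballI impI)
    fix m n
    show "L2_inner M (e m) (e n) = (if m = n then 1 else 0)"
      using main[of m] main[of n] L2_inner_cnj[of M "e m" "e n"]
      by (cases m n rule: linorder_cases) auto
  next
    fix g and \<epsilon> :: real assume g: "g \<in> L2 M" and \<epsilon>: "\<epsilon> > 0"
    \<comment> \<open>The density hypothesis measures squared norms, hence the tolerance \<epsilon>
      squared.\<close>
    obtain N c where 1: "(LINT x|M. (cmod (g x - (\<Sum>n<N. c n * f n x)))\<^sup>2) < \<epsilon>\<^sup>2"
      using dense[OF g, of "\<epsilon>\<^sup>2"] \<epsilon> by auto
    obtain d where "\<And>x. (\<Sum>n<N. c n * f n x) = (\<Sum>n<N. d n * e n x)"
      using span_fe by blast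
    with 1 have "sqrt (LINT x|M. (cmod (g x - (\<Sum>n<N. d n * e n x)))\<^sup>2) < sqrt (\<epsilon>\<^sup>2)"
      by (simp only: real_sqrt_less_iff)
    then have "L2_norm M (\<lambda>x. g x - (\<Sum>n<N. d n * e n x)) < \<epsilon>"
      using \<epsilon> by (simp add: L2_norm_def)
    then show "\<exists>N c. L2_norm M (\<lambda>x. g x - (\<Sum>n<N. c n * e n x)) < \<epsilon>" by blast
  qed (use main in auto)
  then show ?thesis by blast
qed


section \<open>Density of the exponentials in L^2 of the half-line\<close>

lemma nn_integral_half_line:
  "(\<integral>\<^sup>+x. f x \<partial>half_line) = (\<integral>\<^sup>+x. f x * indicator {0<..} x \<partial>lborel)"
  by (subst nn_integral_restrict_space) auto

lemma sigma_finite_half_line: "sigma_finite_measure half_line"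
  by (intro sigma_finite_measure_restrict_space sigma_finite_lborel) auto

lemma borel_measurable_half_line:
  "f \<in> borel_measurable borel \<Longrightarrow> f \<in> borel_measurable half_line"
  by (intro measurable_restrict_space1) simp

lemma L2_exp_minus:
  assumes a: "a > 0"
  shows "(\<lambda>x. complex_of_real (exp (- (a * x)))) \<in> L2 half_line"
proof -
  have "((\<lambda>x. exp (- (2 * a) * x)) has_integral exp (- (2 * a) * 0) / (2 * a)) {0..}"
    using a by (intro has_integral_exp_minus_to_infinity) auto
  from nn_integral_has_integral_lebesgue'[OF _ this]
  have "(\<integral>\<^sup>+x. ennreal (exp (- (2 * a) * x)) * indicator {0..} x \<partial>lborel) < \<infinity>" by simp
  moreover have "(\<integral>\<^sup>+x. ennreal ((cmod (complex_of_real (exp (- (a * x)))))\<^sup>2) \<partial>half_line)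
      \<le> (\<integral>\<^sup>+x. ennreal (exp (- (2 * a) * x)) * indicator {0..} x \<partial>lborel)"
    unfolding nn_integral_half_line
    by (intro nn_integral_mono) (auto simp: indicator_def simp flip: exp_double split: if_splits)
  ultimately show ?thesis
    by (subst L2_iff_nn_integral) (auto intro!: borel_measurable_half_line)
qed

abbreviation exp_poly :: "complex poly \<Rightarrow> real \<Rightarrow> complex" where
  "exp_poly p x \<equiv> complex_of_real (exp (- x)) * poly p (complex_of_real (exp (- x)))"

text \<open>Under \<open>s = e\<^sup>-\<^sup>x\<close> these are the functions \<open>s p(s)\<close> on \<open>(0, 1)\<close>, so that density reduces to
  the Weierstrass approximation theorem.\<close>

definition exp_poly_closure :: "(real \<Rightarrow> complex) set" where
  "exp_poly_closure = {g \<in> L2 half_line. \<forall>\<epsilon>>0. \<exists>p.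
     (LINT x|half_line. (cmod (g x - exp_poly p x))\<^sup>2) < \<epsilon>}"

lemma L2_exp_mult_bounded:
  assumes "f \<in> borel_measurable half_line" and "\<And>x. x > 0 \<Longrightarrow> cmod (f x) \<le> C"
  shows "(\<lambda>x. complex_of_real (exp (- x)) * f x) \<in> L2 half_line"
proof (rule L2_bound)
  note [measurable] = assms(1)
  have [measurable]: "(\<lambda>x::real. complex_of_real (exp (- x))) \<in> borel_measurable half_line"
    by (intro borel_measurable_half_line) measurable
  show "(\<lambda>x. complex_of_real C * complex_of_real (exp (- (1 * x)))) \<in> L2 half_line"
    by (intro L2_scale L2_exp_minus) simp
  show "(\<lambda>x. complex_of_real (exp (- x)) * f x) \<in> borel_measurable half_line" by measurable
  show "AE x in half_line. cmod (complex_of_real (exp (- x)) * f x)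
      \<le> cmod (complex_of_real C * complex_of_real (exp (- (1 * x))))"
    using assms(2) by (auto intro!: AE_I2 simp: norm_mult intro: order_trans[OF _ abs_ge_self])
qed

lemma L2_exp_poly: "exp_poly p \<in> L2 half_line"
proof -
  have "continuous_on (cball 0 1) (poly p)" by (intro continuous_intros)
  then have "bounded (poly p ` cball 0 1)"
    by (intro compact_imp_bounded compact_continuous_image) auto
  then obtain C where C: "\<And>z. cmod z \<le> 1 \<Longrightarrow> cmod (poly p z) \<le> C"
    unfolding bounded_iff by (auto simp: image_iff) (metis mem_cball_0)
  show ?thesis
    by (rule L2_exp_mult_bounded[where C = C])
      (auto intro!: C borel_measurable_half_line borel_measurable_continuous_onI continuous_intros)
qed

lemma exp_poly_in_closure: "exp_poly p \<in> exp_poly_closure"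
  unfolding exp_poly_closure_def using L2_exp_poly[of p] by (auto intro!: exI[of _ p])

text \<open>The closure is itself closed: each of the two approximations is made within \<epsilon> /
  4 to pay for the factor 2 in \<open>L2_sq_norm_add_le\<close>.\<close>

lemma exp_poly_closureI:
  assumes g: "g \<in> L2 half_line"
    and "\<And>\<epsilon>. \<epsilon> > 0 \<Longrightarrow> \<exists>h\<in>exp_poly_closure. (LINT x|half_line. (cmod (g x - h x))\<^sup>2) < \<epsilon>"
  shows "g \<in> exp_poly_closure"
  unfolding exp_poly_closure_def
proof (intro CollectI conjI g allI impI)
  fix \<epsilon> :: real assume \<epsilon>: "\<epsilon> > 0"
  obtain h where h: "h \<in> exp_poly_closure" and 1: "(LINT x|half_line. (cmod (g x - h x))\<^sup>2) < \<epsilon> / 4"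
    using assms(2)[of "\<epsilon> / 4"] \<epsilon> by auto
  obtain p where 2: "(LINT x|half_line. (cmod (h x - exp_poly p x))\<^sup>2) < \<epsilon> / 4"
    using h \<epsilon> unfolding exp_poly_closure_def by (auto dest!: spec[of _ "\<epsilon> / 4"])
  have hL: "h \<in> L2 half_line" using h by (simp add: exp_poly_closure_def)
  have "(LINT x|half_line. (cmod (g x - exp_poly p x))\<^sup>2)
      = (LINT x|half_line. (cmod ((g x - h x) + (h x - exp_poly p x)))\<^sup>2)" by simp
  also have "\<dots> \<le> 2 * (LINT x|half_line. (cmod (g x - h x))\<^sup>2)
      + 2 * (LINT x|half_line. (cmod (h x - exp_poly p x))\<^sup>2)"
    by (intro L2_sq_norm_add_le L2_diff g hL L2_exp_poly)
  also have "\<dots> < \<epsilon>" using 1 2 by simp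
  finally show "\<exists>p. (LINT x|half_line. (cmod (g x - exp_poly p x))\<^sup>2) < \<epsilon>" by blast
qed

lemma exp_poly_closure_scale:
  assumes g: "g \<in> exp_poly_closure"
  shows "(\<lambda>x. c * g x) \<in> exp_poly_closure"
  unfolding exp_poly_closure_def
proof (intro CollectI conjI allI impI)
  show "(\<lambda>x. c * g x) \<in> L2 half_line" using g by (auto simp: exp_poly_closure_def intro: L2_scale)
  fix \<epsilon> :: real assume \<epsilon>: "\<epsilon> > 0"
  \<comment> \<open>The summand 1 keeps the denominator positive when \<open>c = 0\<close>.\<close>
  define d where "d = \<epsilon> / ((cmod c)\<^sup>2 + 1)"
  have "d > 0" using \<epsilon> by (auto simp: d_def intro!: divide_pos_pos add_nonneg_pos)
  then obtain p where p: "(LINT x|half_line. (cmod (g x - exp_poly p x))\<^sup>2) < d"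
    using g unfolding exp_poly_closure_def by blast
  have "(LINT x|half_line. (cmod (c * g x - exp_poly (smult c p) x))\<^sup>2)
      = (LINT x|half_line. (cmod c)\<^sup>2 * (cmod (g x - exp_poly p x))\<^sup>2)"
    by (simp add: algebra_simps flip: power_mult_distrib norm_mult)
  also have "\<dots> \<le> (cmod c)\<^sup>2 * d" using p by (auto intro: mult_left_mono)
  also have "\<dots> < \<epsilon>"
  proof -
    have "0 < (cmod c)\<^sup>2 + 1" by (simp add: add_nonneg_pos)
    then show ?thesis using \<epsilon> by (simp add: d_def field_simps)
  qed
  finally show "\<exists>p. (LINT x|half_line. (cmod (c * g x - exp_poly p x))\<^sup>2) < \<epsilon>" by blast
qed

lemma exp_poly_closure_add:
  assumes "f \<in> exp_poly_closure" "g \<in> exp_poly_closure"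
  shows "(\<lambda>x. f x + g x) \<in> exp_poly_closure"
  unfolding exp_poly_closure_def
proof (intro CollectI conjI allI impI)
  have L: "f \<in> L2 half_line" "g \<in> L2 half_line" using assms by (auto simp: exp_poly_closure_def)
  then show "(\<lambda>x. f x + g x) \<in> L2 half_line" by (intro L2_add)
  fix \<epsilon> :: real assume "\<epsilon> > 0"
  then have "\<epsilon> / 4 > 0" by simp
  with assms obtain p q where pq: "(LINT x|half_line. (cmod (f x - exp_poly p x))\<^sup>2) < \<epsilon> / 4"
      "(LINT x|half_line. (cmod (g x - exp_poly q x))\<^sup>2) < \<epsilon> / 4"
    unfolding exp_poly_closure_def by blast
  have "(LINT x|half_line. (cmod (f x + g x - exp_poly (p + q) x))\<^sup>2)
      = (LINT x|half_line. (cmod ((f x - exp_poly p x) + (g x - exp_poly q x)))\<^sup>2)"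
    by (simp add: algebra_simps)
  also have "\<dots> \<le> 2 * (LINT x|half_line. (cmod (f x - exp_poly p x))\<^sup>2)
      + 2 * (LINT x|half_line. (cmod (g x - exp_poly q x))\<^sup>2)"
    by (intro L2_sq_norm_add_le L2_diff L L2_exp_poly)
  also have "\<dots> < \<epsilon>" using pq by simp
  finally show "\<exists>p. (LINT x|half_line. (cmod (f x + g x - exp_poly p x))\<^sup>2) < \<epsilon>" by blast
qed

lemma exp_poly_closure_zero: "(\<lambda>x. 0) \<in> exp_poly_closure"
  using exp_poly_in_closure[of 0] by simp

lemma exp_poly_closure_sum:
  "(\<And>i. i \<in> A \<Longrightarrow> f i \<in> exp_poly_closure) \<Longrightarrow> (\<lambda>x. \<Sum>i\<in>A. f i x) \<in> exp_poly_closure"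
  by (induction A rule: infinite_finite_induct)
    (auto intro!: exp_poly_closure_zero exp_poly_closure_add)

text \<open>Dominated convergence, with majorant \<open>4 * (cmod (B x))\<^sup>2\<close> for the
  squared differences. This is the single limit principle behind the passage from polynomials to
  continuous functions, indicators and arbitrary elements of L^2.\<close>

lemma exp_poly_closure_limit:
  assumes F: "\<And>k::nat. F k \<in> exp_poly_closure"
    and lim: "\<And>x. x > 0 \<Longrightarrow> (\<lambda>k. F k x) \<longlonglongrightarrow> g x"
    and B: "B \<in> L2 half_line" and bound: "\<And>k x. x > 0 \<Longrightarrow> cmod (F k x) \<le> cmod (B x)"
  shows "g \<in> exp_poly_closure"
proof (rule exp_poly_closureI)
  have FL: "F k \<in> L2 half_line" for k using F by (auto simp: exp_poly_closure_def)
  note [measurable] = FL[THEN L2_measurable]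
  have g_le: "cmod (g x) \<le> cmod (B x)" if "x > 0" for x
    by (rule LIMSEQ_le_const2[OF tendsto_norm[OF lim[OF that]]]) (use bound that in auto)
  have g_meas [measurable]: "g \<in> borel_measurable half_line"
    by (rule borel_measurable_LIMSEQ_metric[of F]) (use lim in auto)
  show gL: "g \<in> L2 half_line"
    by (rule L2_bound[OF B]) (auto intro!: AE_I2 g_le)
  fix \<epsilon> :: real assume \<epsilon>: "\<epsilon> > 0"
  have "(\<lambda>k. LINT x|half_line. (cmod (g x - F k x))\<^sup>2) \<longlonglongrightarrow> (LINT x|half_line. 0)"
  proof (rule integral_dominated_convergence[where w = "\<lambda>x. 4 * (cmod (B x))\<^sup>2"])
    show "integrable half_line (\<lambda>x. 4 * (cmod (B x))\<^sup>2)" using L2_integrable[OF B] by simp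
    show "AE x in half_line. (\<lambda>k. (cmod (g x - F k x))\<^sup>2) \<longlonglongrightarrow> 0"
    proof (rule AE_I2)
      fix x assume "x \<in> space half_line"
      then have "(\<lambda>k. (cmod (g x - F k x))\<^sup>2) \<longlonglongrightarrow> (cmod (g x - g x))\<^sup>2"
        using lim by (intro tendsto_intros) auto
      then show "(\<lambda>k. (cmod (g x - F k x))\<^sup>2) \<longlonglongrightarrow> 0" by simp
    qed
    show "AE x in half_line. norm ((cmod (g x - F k x))\<^sup>2) \<le> 4 * (cmod (B x))\<^sup>2" for k
    proof (rule AE_I2)
      fix x assume "x \<in> space half_line"
      then have "cmod (g x - F k x) \<le> 2 * cmod (B x)"
        using g_le[of x] bound[of x k] norm_triangle_ineq4[of "g x" "F k x"] by simp
      then have "(cmod (g x - F k x))\<^sup>2 \<le> (2 * cmod (B x))\<^sup>2" by (intro power_mono) auto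
      then show "norm ((cmod (g x - F k x))\<^sup>2) \<le> 4 * (cmod (B x))\<^sup>2" by (simp add: power_mult_distrib)
    qed
  qed auto
  then have "\<forall>\<^sub>F k in sequentially. (LINT x|half_line. (cmod (g x - F k x))\<^sup>2) < \<epsilon>"
    using \<epsilon> by (intro order_tendstoD) auto
  then show "\<exists>h\<in>exp_poly_closure. (LINT x|half_line. (cmod (g x - h x))\<^sup>2) < \<epsilon>"
    using F by (auto simp: eventually_sequentially)
qed

text \<open>Uniform approximation on [0, 1] suffices because the common factor
  \<open>exp (- x)\<close> is square integrable.\<close>

lemma exp_poly_closure_continuous:
  fixes g :: "real \<Rightarrow> real"
  assumes g: "continuous_on {0..1} g"
  shows "(\<lambda>x. complex_of_real (exp (- x)) * complex_of_real (g (exp (- x)))) \<in> exp_poly_closure"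
proof -
  have "\<forall>n. \<exists>p :: complex poly. \<forall>s\<in>{0..1}.
      cmod (complex_of_real (g s) - poly p (complex_of_real s)) < inverse (Suc n)"
  proof
    fix n
    obtain N where N: "\<And>x. x \<in> {0..1} \<Longrightarrow>
        \<bar>g x - (\<Sum>k\<le>N. g (k / N) * Bernstein N k x)\<bar> < inverse (Suc n)"
      using Bernstein_Weierstrass[OF g, of "inverse (Suc n)"] by auto
    \<comment> \<open>The Bernstein sum as a complex polynomial: \<open>monom 1 k\<close> and
      \<open>[:1, -1:] ^ (N - k)\<close> evaluate to s^k and (1 - s)^(N - k).\<close>
    define p :: "complex poly" where "p = (\<Sum>k\<le>N. smult (of_real (g (k / N)) * of_nat (N choose k))
      (monom 1 k * [:1, -1:] ^ (N - k)))"
    have p: "poly p (complex_of_real s) = complex_of_real (\<Sum>k\<le>N. g (k / N) * Bernstein N k s)" for s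
      by (simp add: p_def poly_sum poly_monom Bernstein_def mult.assoc)
    have "cmod (complex_of_real (g s) - poly p (complex_of_real s)) < inverse (Suc n)"
      if "s \<in> {0..1}" for s
      using N[OF that] unfolding p by (simp only: norm_of_real flip: of_real_diff)
    then show "\<exists>p :: complex poly. \<forall>s\<in>{0..1}.
        cmod (complex_of_real (g s) - poly p (complex_of_real s)) < inverse (Suc n)" by blast
  qed
  then obtain P :: "nat \<Rightarrow> complex poly" where P: "\<And>n s. s \<in> {0..1} \<Longrightarrow>
      cmod (complex_of_real (g s) - poly (P n) (complex_of_real s)) < inverse (Suc n)"
    by metis
  obtain C where C: "\<forall>s\<in>{0..1}. \<bar>g s\<bar> \<le> C"
    using compact_imp_bounded[OF compact_continuous_image[OF g]] by (auto simp: bounded_iff)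
  show ?thesis
  proof (rule exp_poly_closure_limit)
    show "exp_poly (P n) \<in> exp_poly_closure" for n by (rule exp_poly_in_closure)
    \<comment> \<open>\<open>C\<close> bounds \<open>g\<close>, and the extra 1 covers the
      approximation error \<open>inverse (Suc n)\<close>.\<close>
    show "(\<lambda>x. complex_of_real (C + 1) * complex_of_real (exp (- (1 * x)))) \<in> L2 half_line"
      by (intro L2_scale L2_exp_minus) simp
    fix x :: real assume x: "x > 0"
    define s where "s = exp (- x)"
    have s: "s \<in> {0..1}" using x by (simp add: s_def)
    have "(\<lambda>n. complex_of_real (g s) - poly (P n) (complex_of_real s)) \<longlonglongrightarrow> 0"
      by (rule Lim_null_comparison[OF _ LIMSEQ_inverse_real_of_nat])
        (use P[OF s] in \<open>auto intro!: always_eventually less_imp_le\<close>)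
    then have "(\<lambda>n. complex_of_real (g s) - (complex_of_real (g s) - poly (P n) (complex_of_real s)))
        \<longlonglongrightarrow> complex_of_real (g s) - 0"
      by (intro tendsto_diff tendsto_const)
    then show "(\<lambda>n. exp_poly (P n) x) \<longlonglongrightarrow> complex_of_real (exp (- x)) * complex_of_real (g (exp (- x)))"
      by (intro tendsto_mult tendsto_const) (simp add: s_def)
    fix n
    have "cmod (poly (P n) (complex_of_real s)) \<le> cmod (complex_of_real (g s))
        + cmod (complex_of_real (g s) - poly (P n) (complex_of_real s))"
      using norm_triangle_ineq4[of "complex_of_real (g s)" "complex_of_real (g s) - poly (P n) (complex_of_real s)"]
      by simp
    also have "\<dots> \<le> C + inverse (Suc n)"
      using C[rule_format, OF s] less_imp_le[OF P[OF s, of n]] by (intro add_mono) auto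
    also have "\<dots> \<le> \<bar>C + 1\<bar>"
      by (intro order_trans[OF _ abs_ge_self] add_left_mono) (simp add: field_simps)
    finally show "cmod (exp_poly (P n) x) \<le> cmod (complex_of_real (C + 1) * complex_of_real (exp (- (1 * x))))"
      by (simp add: s_def norm_mult)
  qed
qed

lemma exp_poly_closure_atMost:
  "(\<lambda>x. complex_of_real (exp (- x)) * indicator {..a} x) \<in> exp_poly_closure"
proof (rule exp_poly_closure_limit)
  define b where "b = exp (- a)"
  \<comment> \<open>In the variable s = \<open>exp (- x)\<close> the set x \<le> a becomes s \<ge>
    b. The ramp is 1 there, endpoint included, and for k > 0 falls to 0 at distance 1/k below
    \<open>b\<close>.\<close>
  define g where "g k s = max 0 (min 1 (1 + real k * (s - b)))" for k s
  show "(\<lambda>x. complex_of_real (exp (- x)) * complex_of_real (g k (exp (- x)))) \<in> exp_poly_closure" for k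
    unfolding g_def by (intro exp_poly_closure_continuous continuous_intros)
  show "(\<lambda>x. complex_of_real (exp (- (1 * x)))) \<in> L2 half_line" by (intro L2_exp_minus) simp
  show "cmod (complex_of_real (exp (- x)) * complex_of_real (g k (exp (- x))))
      \<le> cmod (complex_of_real (exp (- (1 * x))))" for k x
    by (simp add: norm_mult g_def)
  fix x :: real
  have "(\<lambda>k. g k (exp (- x))) \<longlonglongrightarrow> indicator {..a} x"
  proof (cases "x \<le> a")
    case True
    then have "0 \<le> real k * (exp (- x) - b)" for k by (simp add: b_def)
    then have "g k (exp (- x)) = 1" for k by (simp add: g_def)
    then show ?thesis using True by simp
  next
    case False
    then have d: "b - exp (- x) > 0" by (simp add: b_def)
    obtain N :: nat where N: "1 < real N * (b - exp (- x))"
      using ex_less_of_nat_mult[OF d] by blast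
    have "g k (exp (- x)) = 0" if "k \<ge> N" for k
    proof -
      have "real N * (b - exp (- x)) \<le> real k * (b - exp (- x))"
        using that d by (intro mult_right_mono) auto
      then show ?thesis using N by (simp add: g_def algebra_simps)
    qed
    then have "\<forall>\<^sub>F k in sequentially. g k (exp (- x)) = 0" by (auto simp: eventually_sequentially)
    then show ?thesis using False by (simp add: tendsto_eventually)
  qed
  then have "(\<lambda>k. complex_of_real (g k (exp (- x)))) \<longlonglongrightarrow> complex_of_real (indicator {..a} x)"
    by (rule tendsto_of_real)
  then show "(\<lambda>k. complex_of_real (exp (- x)) * complex_of_real (g k (exp (- x))))
      \<longlonglongrightarrow> complex_of_real (exp (- x)) * indicator {..a} x"
    by (intro tendsto_mult tendsto_const) (cases "x \<le> a"; simp)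
qed

text \<open>Dynkin induction from the intersection-stable generator of sets \<open>{..a}\<close>:
  complements are taken by subtracting from \<open>exp (- x)\<close>, disjoint unions are dominated
  limits of partial sums. The weight \<open>exp (- x)\<close> admits sets of infinite
  measure.\<close>

lemma exp_poly_closure_indicator:
  assumes "A \<in> sets (borel :: real measure)"
  shows "(\<lambda>x. complex_of_real (exp (- x)) * indicator A x) \<in> exp_poly_closure"
proof -
  let ?G = "range (\<lambda>a::real. {..a})"
  have "Int_stable ?G" by (auto simp: Int_stable_def)
  moreover have "?G \<subseteq> Pow UNIV" by simp
  moreover have "A \<in> sigma_sets UNIV ?G" using assms by (simp add: borel_eq_atMost)
  ultimately show ?thesis
  proof (induction rule: sigma_sets_induct_disjoint)
    case (basic A)
    then show ?case using exp_poly_closure_atMost by auto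
  next
    case empty
    then show ?case using exp_poly_closure_zero by simp
  next
    case (compl A)
    have "(\<lambda>x. exp_poly 1 x + (- 1) * (complex_of_real (exp (- x)) * indicator A x)) \<in> exp_poly_closure"
      by (intro exp_poly_closure_add exp_poly_closure_scale exp_poly_in_closure compl)
    moreover have "exp_poly 1 x + (- 1) * (complex_of_real (exp (- x)) * indicator A x)
        = complex_of_real (exp (- x)) * indicator (UNIV - A) x" for x
      by (simp add: indicator_def)
    ultimately show ?case by simp
  next
    case (union A)
    show ?case
    proof (rule exp_poly_closure_limit)
      show "(\<lambda>x. \<Sum>i<k. complex_of_real (exp (- x)) * indicator (A i) x) \<in> exp_poly_closure" for k
        using union by (intro exp_poly_closure_sum) auto
      show "(\<lambda>x. complex_of_real (exp (- (1 * x)))) \<in> L2 half_line" by (intro L2_exp_minus) simp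
      fix x :: real
      have eq: "(\<Sum>i<k. complex_of_real (exp (- x)) * indicator (A i) x)
          = complex_of_real (exp (- x)) * indicator (\<Union>i<k. A i) x" for k
        using union(1) by (simp add: indicator_UN_disjoint disjoint_family_on_def sum_distrib_left)
      show "cmod (\<Sum>i<k. complex_of_real (exp (- x)) * indicator (A i) x)
          \<le> cmod (complex_of_real (exp (- (1 * x))))" for k
        unfolding eq by (simp add: norm_mult indicator_def)
      have "(\<lambda>k. indicator (\<Union>i<k. A i) x :: complex) \<longlonglongrightarrow> indicator (\<Union>i. A i) x"
        by (rule LIMSEQ_indicator_UN)
      then show "(\<lambda>k. \<Sum>i<k. complex_of_real (exp (- x)) * indicator (A i) x)
          \<longlonglongrightarrow> complex_of_real (exp (- x)) * indicator (\<Union>i. A i) x"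
        unfolding eq by (intro tendsto_mult tendsto_const)
    qed
  qed
qed

text \<open>Simple functions approximate \<open>exp x * g x\<close> instead of \<open>g\<close>,
  because the available indicators carry the weight \<open>exp (- x)\<close>. Multiplying by the
  weight recovers \<open>g\<close>, and the factor 2 in the simple approximation becomes the
  majorant \<open>2 * g x\<close>.\<close>

lemma exp_poly_dense:
  assumes g: "g \<in> L2 half_line"
  shows "g \<in> exp_poly_closure"
proof -
  note [measurable] = L2_measurable[OF g]
  have [measurable]: "(\<lambda>x::real. complex_of_real (exp x)) \<in> borel_measurable half_line"
    by (intro borel_measurable_half_line) measurable
  have "(\<lambda>x. complex_of_real (exp x) * g x) \<in> borel_measurable half_line" by measurable
  from borel_measurable_implies_sequence_metric[OF this, of 0]
  obtain F where F: "\<forall>i. simple_function half_line (F i)"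
    and lim: "\<forall>x\<in>{0<..}. (\<lambda>i. F i x) \<longlonglongrightarrow> complex_of_real (exp x) * g x"
    and bound: "\<forall>i. \<forall>x\<in>{0<..}. cmod (F i x) \<le> 2 * cmod (complex_of_real (exp x) * g x)"
    by auto
  define S where "S i x = (\<Sum>y\<in>F i ` {0<..}. y * (complex_of_real (exp (- x)) *
    indicator (F i -` {y} \<inter> {0<..}) x))" for i x
  have S: "S i x = complex_of_real (exp (- x)) * F i x" if "x > 0" for i x
  proof -
    have fin: "finite (F i ` {0<..})" using F by (simp add: simple_function_def)
    have "S i x = (\<Sum>y\<in>F i ` {0<..}. if y = F i x then y * complex_of_real (exp (- x)) else 0)"
      unfolding S_def using that by (intro sum.cong) (auto simp: indicator_def)
    also have "\<dots> = complex_of_real (exp (- x)) * F i x" using that fin by auto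
    finally show ?thesis .
  qed
  show ?thesis
  proof (rule exp_poly_closure_limit)
    show "S i \<in> exp_poly_closure" for i
      unfolding S_def
    proof (intro exp_poly_closure_sum exp_poly_closure_scale exp_poly_closure_indicator)
      fix y assume "y \<in> F i ` {0<..}"
      have "F i -` {y} \<inter> space half_line \<in> sets half_line"
        using F by (intro simple_functionD) simp
      then show "F i -` {y} \<inter> {0<..} \<in> sets borel" by (auto simp: sets_restrict_space)
    qed
    show "(\<lambda>x. 2 * g x) \<in> L2 half_line" by (intro L2_scale g)
    fix x :: real assume x: "x > 0"
    have "(\<lambda>i. complex_of_real (exp (- x)) * F i x)
        \<longlonglongrightarrow> complex_of_real (exp (- x)) * (complex_of_real (exp x) * g x)"
      using lim x by (intro tendsto_mult tendsto_const) auto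
    moreover have "complex_of_real (exp (- x)) * (complex_of_real (exp x) * g x) = g x"
      by (simp add: exp_minus)
    ultimately show "(\<lambda>i. S i x) \<longlonglongrightarrow> g x" using S[OF x] by simp
    fix i
    have "cmod (S i x) \<le> exp (- x) * (2 * cmod (complex_of_real (exp x) * g x))"
      unfolding S[OF x] norm_mult using bound x by (auto simp: norm_mult)
    also have "\<dots> = cmod (2 * g x)" by (simp add: norm_mult exp_minus)
    finally show "cmod (S i x) \<le> cmod (2 * g x)" .
  qed
qed

lemma exp_minus_Suc_mult:
  "complex_of_real (exp (- (real (Suc n) * x)))
    = complex_of_real (exp (- x)) * complex_of_real (exp (- x)) ^ n"
proof -
  have "- (real (Suc n) * x) = - x + real n * (- x)" by (simp add: algebra_simps)
  then show ?thesis by (simp only: exp_add exp_of_nat_mult of_real_mult of_real_power)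
qed

lemma exp_poly_eq_sum:
  "exp_poly p x = (\<Sum>n<Suc (degree p). coeff p n * complex_of_real (exp (- (real (Suc n) * x))))"
  unfolding exp_minus_Suc_mult poly_altdef lessThan_Suc_atMost
  by (simp add: sum_distrib_left algebra_simps)

text \<open>A nonzero value would persist on a ball, which has positive Lebesgue measure.\<close>

lemma AE_half_line_continuous_eq_0:
  fixes f :: "real \<Rightarrow> complex"
  assumes ae: "AE x in half_line. f x = 0" and cont: "continuous_on {0<..} f" and x: "x > 0"
  shows "f x = 0"
proof (rule ccontr)
  assume "f x \<noteq> 0"
  have "open {y \<in> {0<..}. f y \<noteq> 0}"
    using continuous_open_preimage[OF cont, of "- {0}"]
    by (simp add: vimage_def Int_def open_Compl)
  moreover have "x \<in> {y \<in> {0<..}. f y \<noteq> 0}" using x \<open>f x \<noteq> 0\<close> by simp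
  ultimately obtain d where d: "d > 0" "ball x d \<subseteq> {y \<in> {0<..}. f y \<noteq> 0}"
    by (meson open_contains_ball)
  have "AE y in lborel. y \<in> {0<..} \<longrightarrow> f y = 0"
    using ae by (subst (asm) AE_restrict_space_iff) auto
  then have "AE y in lborel. y \<notin> ball x d"
    using d(2) by (auto elim!: eventually_mono)
  then have "ball x d \<in> null_sets lborel" by (subst AE_iff_null_sets) auto
  then have "emeasure lborel (ball x d) = 0" by auto
  moreover have "emeasure lborel (ball x d) = ennreal (2 * d)"
    using d(1) by (simp add: ball_eq_greaterThanLessThan)
  ultimately show False using d(1) by simp
qed

lemma orthonormal_basis_half_line: "\<exists>e. orthonormal_basis half_line e"
proof (rule orthonormal_basis_exists)
  let ?f = "\<lambda>n x. complex_of_real (exp (- (real (Suc n) * x)))"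
  show f: "?f n \<in> L2 half_line" for n by (rule L2_exp_minus) simp
  show "\<exists>N c. (LINT x|half_line. (cmod (g x - (\<Sum>n<N. c n * ?f n x)))\<^sup>2) < \<epsilon>"
    if g: "g \<in> L2 half_line" and \<epsilon>: "\<epsilon> > 0" for g \<epsilon>
  proof -
    obtain p where "(LINT x|half_line. (cmod (g x - exp_poly p x))\<^sup>2) < \<epsilon>"
      using exp_poly_dense[OF g] \<epsilon> unfolding exp_poly_closure_def by blast
    then show ?thesis unfolding exp_poly_eq_sum by blast
  qed
  show "(LINT x|half_line. (cmod (?f N x - (\<Sum>n<N. c n * ?f n x)))\<^sup>2) \<noteq> 0" for N c
  proof
    \<comment> \<open>A combination of norm zero would force \<open>q\<close> to vanish at every
      \<open>exp (- x)\<close> with x > 0, infinitely many points, although its coefficient at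
      \<open>N\<close> is 1.\<close>
    define q :: "complex poly" where "q = monom 1 N - (\<Sum>n<N. monom (c n) n)"
    have q: "?f N x - (\<Sum>n<N. c n * ?f n x) = exp_poly q x" for x
      unfolding exp_minus_Suc_mult q_def
      by (simp add: poly_sum poly_monom sum_distrib_left algebra_simps)

    assume "(LINT x|half_line. (cmod (?f N x - (\<Sum>n<N. c n * ?f n x)))\<^sup>2) = 0"
    then have "AE x in half_line. (cmod (exp_poly q x))\<^sup>2 = 0"
      unfolding q using integral_nonneg_eq_0_iff_AE[OF L2_integrable[OF L2_exp_poly[of q]]] by simp
    then have "AE x in half_line. exp_poly q x = 0" by simp
    then have "exp_poly q x = 0" if "x > 0" for x
      by (rule AE_half_line_continuous_eq_0) (use that in \<open>auto intro!: continuous_intros\<close>)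
    then have "poly q (complex_of_real (exp (- x))) = 0" if "x > 0" for x using that by simp
    then have "(\<lambda>x. complex_of_real (exp (- x))) ` {0<..} \<subseteq> {z. poly q z = 0}" by auto
    moreover have "infinite ((\<lambda>x. complex_of_real (exp (- x))) ` {0<..})"
      by (subst finite_image_iff) (auto simp: inj_on_def infinite_Ioi)
    ultimately have "q = 0" using poly_roots_finite finite_subset by blast
    moreover have "coeff q N = 1" by (simp add: q_def coeff_sum)
    ultimately show False by simp
  qed
qed


section \<open>Beta and Gamma integrals\<close>

text \<open>Substitution t = u s: the two powers contribute u^(2b) and dt contributes one more
  u.\<close>

lemma nn_integral_Beta_scaled:
  fixes b u :: real
  assumes b: "b > -1" and u: "u > 0"
  shows "(\<integral>\<^sup>+t. ennreal (t powr b * (u - t) powr b) * indicator {0<..<u} t \<partial>lborel)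
    = ennreal (Beta (b + 1) (b + 1)) * ennreal (u powr (2 * b + 1))"
proof -
  have pos: "s > 0 \<longleftrightarrow> u * s > 0" "s < 1 \<longleftrightarrow> u * s < u" for s using u by (simp_all add: zero_less_mult_iff)
  have "((\<lambda>s. s powr b * (1 - s) powr b) has_integral Beta (b + 1) (b + 1)) {0..1}"
    using has_integral_Beta_real[of "b + 1" "b + 1"] b by simp
  from nn_integral_has_integral_lebesgue'[OF _ this]
  have Beta: "(\<integral>\<^sup>+s. ennreal (s powr b * (1 - s) powr b) * indicator {0..1} s \<partial>lborel)
      = ennreal (Beta (b + 1) (b + 1))" by simp
  have "(\<integral>\<^sup>+t. ennreal (t powr b * (u - t) powr b) * indicator {0<..<u} t \<partial>lborel)
     = ennreal u * (\<integral>\<^sup>+s. ennreal ((u * s) powr b * (u - u * s) powr b) * indicator {0<..<u} (u * s) \<partial>lborel)"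
    using u by (subst nn_integral_real_affine[where c = u and t = 0]) auto
  also have "(\<integral>\<^sup>+s. ennreal ((u * s) powr b * (u - u * s) powr b) * indicator {0<..<u} (u * s) \<partial>lborel)
     = (\<integral>\<^sup>+s. ennreal (u powr (2 * b)) * (ennreal (s powr b * (1 - s) powr b) * indicator {0..1} s) \<partial>lborel)"
  proof (intro nn_integral_cong)
    fix s :: real
    show "ennreal ((u * s) powr b * (u - u * s) powr b) * indicator {0<..<u} (u * s)
      = ennreal (u powr (2 * b)) * (ennreal (s powr b * (1 - s) powr b) * indicator {0..1} s)"
    proof (cases "0 < s \<and> s < 1")
      case True
      have "(u * s) powr b * (u - u * s) powr b = (u * s) powr b * (u * (1 - s)) powr b"
        by (simp add: algebra_simps)
      also have "\<dots> = u powr (2 * b) * (s powr b * (1 - s) powr b)"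
        using True u by (simp add: powr_mult flip: powr_add mult_2)
      finally have "(u * s) powr b * (u - u * s) powr b = u powr (2 * b) * (s powr b * (1 - s) powr b)" .
      moreover have "s \<in> {0..1}" "u * s \<in> {0<..<u}" using True pos[of s] by (simp_all add: less_imp_le)
      ultimately show ?thesis by (simp add: ennreal_mult)
    next
      case False
      then have "u * s \<notin> {0<..<u}" using pos by auto
      \<comment> \<open>At the endpoints 0 and 1 the product vanishes for every \<open>b\<close>,
        since \<open>0 powr b = 0\<close>; hence open and closed intervals agree pointwise.\<close>
      moreover have "s powr b * (1 - s) powr b = 0 \<or> s \<notin> {0..1}" using False by auto
      ultimately show ?thesis by auto
    qed
  qed
  also have "\<dots> = ennreal (u powr (2 * b)) * ennreal (Beta (b + 1) (b + 1))"
    by (subst nn_integral_cmult) (auto simp: Beta)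
  also have "ennreal u * (ennreal (u powr (2 * b)) * ennreal (Beta (b + 1) (b + 1)))
      = ennreal (Beta (b + 1) (b + 1)) * ennreal (u * u powr (2 * b))"
    using u by (simp add: ennreal_mult mult_ac)
  also have "u * u powr (2 * b) = u powr (2 * b + 1)"
    using u by (simp add: powr_add)
  finally show ?thesis .
qed

lemma nn_integral_hankel_kernel:
  fixes \<phi> :: "real \<Rightarrow> ennreal"
  assumes b: "b > -1" and [measurable]: "\<phi> \<in> borel_measurable borel"
  shows "(\<integral>\<^sup>+t. \<integral>\<^sup>+\<tau>. ennreal (t powr b * \<tau> powr b) * \<phi> (t + \<tau>) \<partial>half_line \<partial>half_line)
    = ennreal (Beta (b + 1) (b + 1)) *
      (\<integral>\<^sup>+u. ennreal (u powr (2 * b + 1)) * \<phi> u * indicator {0<..} u \<partial>lborel)"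
proof -
  \<comment> \<open>With both indicators inside the integrand the integrals run over the whole line,
    where translation and Tonelli are available.\<close>
  define F where "F t \<tau> = ennreal (t powr b * \<tau> powr b) * \<phi> (t + \<tau>)
    * indicator {0<..} \<tau> * indicator {0<..} t" for t \<tau>
  have [measurable]: "case_prod F \<in> borel_measurable (borel \<Otimes>\<^sub>M borel)" unfolding F_def by measurable
  have "(\<integral>\<^sup>+t. \<integral>\<^sup>+\<tau>. ennreal (t powr b * \<tau> powr b) * \<phi> (t + \<tau>) \<partial>half_line \<partial>half_line)
      = (\<integral>\<^sup>+t. \<integral>\<^sup>+\<tau>. F t \<tau> \<partial>lborel \<partial>lborel)"
    unfolding nn_integral_half_line F_def by (subst nn_integral_multc) auto
  also have "\<dots> = (\<integral>\<^sup>+t. \<integral>\<^sup>+u. F t (u - t) \<partial>lborel \<partial>lborel)"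
  proof (rule nn_integral_cong)
    fix t
    show "(\<integral>\<^sup>+\<tau>. F t \<tau> \<partial>lborel) = (\<integral>\<^sup>+u. F t (u - t) \<partial>lborel)"
      by (subst nn_integral_real_affine[where c = 1 and t = "- t"]) auto
  qed
  also have "\<dots> = (\<integral>\<^sup>+u. \<integral>\<^sup>+t. F t (u - t) \<partial>lborel \<partial>lborel)"
    by (rule lborel_pair.Fubini'[where f = "\<lambda>u t. F t (u - t)"]) measurable
  also have "\<dots> = (\<integral>\<^sup>+u. ennreal (Beta (b + 1) (b + 1)) *
      (ennreal (u powr (2 * b + 1)) * \<phi> u * indicator {0<..} u) \<partial>lborel)"
  proof (intro nn_integral_cong)
    fix u
    \<comment> \<open>On the line t + \<tau> = u the two positivity conditions leave exactly 0 < t <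
      u.\<close>
    have "F t (u - t) = ennreal (t powr b * (u - t) powr b) * indicator {0<..<u} t * \<phi> u" for t
      by (auto simp: F_def indicator_def mult_ac)
    then have eq: "(\<integral>\<^sup>+t. F t (u - t) \<partial>lborel)
        = (\<integral>\<^sup>+t. ennreal (t powr b * (u - t) powr b) * indicator {0<..<u} t \<partial>lborel) * \<phi> u"
      by (simp add: nn_integral_multc)
    show "(\<integral>\<^sup>+t. F t (u - t) \<partial>lborel) = ennreal (Beta (b + 1) (b + 1)) *
      (ennreal (u powr (2 * b + 1)) * \<phi> u * indicator {0<..} u)"
    proof (cases "u > 0")
      case True
      then show ?thesis unfolding eq nn_integral_Beta_scaled[OF b True] by (simp add: mult_ac)
    next
      case False
      then have "{0<..<u} = {}" by auto
      then show ?thesis unfolding eq using False by simp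
    qed
  qed
  finally show ?thesis by (simp add: nn_integral_cmult)
qed

lemma nn_integral_Gamma_scaled:
  fixes a c :: real
  assumes a: "a > 0" and c: "c > 0"
  shows "(\<integral>\<^sup>+u. ennreal (u powr (a - 1) * exp (- (c * u))) * indicator {0<..} u \<partial>lborel)
    = ennreal (Gamma a) * ennreal (1 / c powr a)"
proof -
  have Gamma: "(\<integral>\<^sup>+v. ennreal (v powr (a - 1) / exp v) * indicator {0..} v \<partial>lborel) = ennreal (Gamma a)"
    by (rule nn_integral_has_integral_lebesgue'[OF _ Gamma_integral_real[OF a]]) simp
  have "ennreal (Gamma a)
      = ennreal c * (\<integral>\<^sup>+u. ennreal ((c * u) powr (a - 1) / exp (c * u)) * indicator {0..} (c * u) \<partial>lborel)"
    unfolding Gamma[symmetric] using c by (subst nn_integral_real_affine[where c = c and t = 0]) auto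
  also have "\<dots> = (\<integral>\<^sup>+u. ennreal c * (ennreal ((c * u) powr (a - 1) / exp (c * u)) * indicator {0..} (c * u)) \<partial>lborel)"
    by (simp add: nn_integral_cmult)
  also have "\<dots> = (\<integral>\<^sup>+u. ennreal (c powr a) * (ennreal (u powr (a - 1) * exp (- (c * u))) * indicator {0<..} u) \<partial>lborel)"
  proof (intro nn_integral_cong)
    fix u :: real
    show "ennreal c * (ennreal ((c * u) powr (a - 1) / exp (c * u)) * indicator {0..} (c * u))
      = ennreal (c powr a) * (ennreal (u powr (a - 1) * exp (- (c * u))) * indicator {0<..} u)"
    proof (cases "u > 0")
      case True
      have "c powr a = c * c powr (a - 1)" using c by (simp add: powr_diff)
      then have "c * ((c * u) powr (a - 1) / exp (c * u)) = c powr a * (u powr (a - 1) * exp (- (c * u)))"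
        using True c by (simp add: powr_mult exp_minus field_simps)
      then show ?thesis using True c by (simp flip: ennreal_mult)
    next
      case False
      \<comment> \<open>At \<open>u = 0\<close> the integrand is 0 by the convention
        \<open>0 powr (a - 1) = 0\<close>; for negative \<open>u\<close> both indicators
        vanish.\<close>
      then have "u = 0 \<or> c * u < 0" using c by (auto simp: not_less le_less mult_pos_neg)
      then show ?thesis using False by auto
    qed
  qed
  also have "\<dots> = ennreal (c powr a) * (\<integral>\<^sup>+u. ennreal (u powr (a - 1) * exp (- (c * u))) * indicator {0<..} u \<partial>lborel)"
    by (simp add: nn_integral_cmult)
  finally have "ennreal (Gamma a) * ennreal (1 / c powr a) = (ennreal (1 / c powr a) * ennreal (c powr a))
      * (\<integral>\<^sup>+u. ennreal (u powr (a - 1) * exp (- (c * u))) * indicator {0<..} u \<partial>lborel)"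
    by (simp add: mult_ac)
  also have "ennreal (1 / c powr a) * ennreal (c powr a) = 1"
    using c by (simp flip: ennreal_mult)
  finally show ?thesis by simp
qed


section \<open>Weighted Hankel operators\<close>

text \<open>Confinement to [t/2, 2t] keeps the approximants away from 0 and infinity, so that one
  majorant serves all of them.\<close>

lemma rational_approximation:
  assumes t: "(t::real) > 0"
  obtains q where "q \<longlonglongrightarrow> t" "\<And>k::nat. q k \<in> \<rat>" "\<And>k. t / 2 \<le> q k \<and> q k \<le> 2 * t"
proof -
  have "\<forall>k::nat. \<exists>x. x \<in> \<rat> \<and> t < x \<and> x < t + min t (inverse (Suc k))"
    using t Rats_dense_in_real[of t "t + min t (inverse (Suc k))" for k :: nat] by fastforce
  then obtain q where q: "\<forall>k::nat. q k \<in> \<rat> \<and> t < q k \<and> q k < t + min t (inverse (Suc k))"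
    unfolding choice_iff by blast
  have up: "q k \<le> t + inverse (Suc k)" "q k \<le> 2 * t" "t \<le> q k" for k
    using q[rule_format, of k] by auto
  have "q \<longlonglongrightarrow> t"
  proof (rule tendsto_sandwich[of "\<lambda>_. t" q sequentially "\<lambda>k. t + inverse (real (Suc k))"])
    show "(\<lambda>k. t + inverse (real (Suc k))) \<longlonglongrightarrow> t"
      using tendsto_add[OF tendsto_const[of t] LIMSEQ_inverse_real_of_nat] by simp
    show "(\<lambda>k::nat. t) \<longlonglongrightarrow> t" by (rule tendsto_const)
  qed (use up in \<open>auto intro!: always_eventually simp del: of_nat_Suc\<close>)
  then show ?thesis
  proof (rule that)
    show "q k \<in> \<rat>" for k using q by blast
    show "t / 2 \<le> q k \<and> q k \<le> 2 * t" for k using up[of k] t by linarith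
  qed
qed

context
  fixes h :: "real \<Rightarrow> complex" and w :: "real \<Rightarrow> real" and \<alpha> :: real
  assumes cont: "continuous_on {0<..} h"
    and w: "\<And>t. t > 0 \<Longrightarrow> w t = t powr \<alpha>"
    and \<alpha>: "\<alpha> > - 1 / 2"
begin

definition hankel_kernel :: "real \<Rightarrow> real \<Rightarrow> complex" where
  "hankel_kernel t \<tau> = complex_of_real (w t) * h (t + \<tau>) * complex_of_real (w \<tau>)"

text \<open>Off \<open>(0, \<infinity>)\<close> the function \<open>h\<close> is arbitrary and need not be measurable.\<close>

definition h_ext :: "real \<Rightarrow> complex" where
  "h_ext x = (if x \<in> {0<..} then h x else 0)"

lemma h_ext_measurable [measurable]: "h_ext \<in> borel_measurable borel"
  unfolding h_ext_def by (intro borel_measurable_continuous_on_if cont) auto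

lemma ident_measurable_half_line [measurable]: "(\<lambda>x. x) \<in> half_line \<rightarrow>\<^sub>M borel"
  by (intro borel_measurable_half_line) simp

lemma hankel_kernel_ext:
  "t > 0 \<Longrightarrow> \<tau> > 0 \<Longrightarrow> hankel_kernel t \<tau> = complex_of_real (t powr \<alpha>) * h_ext (t + \<tau>) * complex_of_real (\<tau> powr \<alpha>)"
  by (simp add: hankel_kernel_def h_ext_def w)

lemma measurable_fst_snd_half_line [measurable]:
  "fst \<in> half_line \<Otimes>\<^sub>M half_line \<rightarrow>\<^sub>M borel" "snd \<in> half_line \<Otimes>\<^sub>M half_line \<rightarrow>\<^sub>M borel"
  using measurable_compose[OF measurable_fst ident_measurable_half_line]
    measurable_compose[OF measurable_snd ident_measurable_half_line] by simp_all

lemma hankel_kernel_measurable: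
  "case_prod hankel_kernel \<in> borel_measurable (half_line \<Otimes>\<^sub>M half_line)"
proof -
  have "(\<lambda>p. complex_of_real (fst p powr \<alpha>) * h_ext (fst p + snd p) * complex_of_real (snd p powr \<alpha>))
      \<in> borel_measurable (half_line \<Otimes>\<^sub>M half_line)" by measurable
  moreover have "case_prod hankel_kernel p
      = complex_of_real (fst p powr \<alpha>) * h_ext (fst p + snd p) * complex_of_real (snd p powr \<alpha>)"
    if "p \<in> space (half_line \<Otimes>\<^sub>M half_line)" for p
    using that by (cases p) (auto simp: space_pair_measure hankel_kernel_ext)
  ultimately show ?thesis by (simp cong: measurable_cong)
qed

lemma hankel_kernel_section_measurable [measurable]:
  "t > 0 \<Longrightarrow> hankel_kernel t \<in> borel_measurable half_line"
  using measurable_compose_Pair1[OF _ hankel_kernel_measurable, of t] by simp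

text \<open>Squaring the weights doubles the exponent, so the Beta computation is used with b =
  2\<alpha>; its condition b > -1 is \<alpha> > -1/2.\<close>

lemma hankel_kernel_sq_integral:
  "(\<integral>\<^sup>+t. \<integral>\<^sup>+\<tau>. ennreal ((cmod (hankel_kernel t \<tau>))\<^sup>2) \<partial>half_line \<partial>half_line)
    = ennreal (Beta (2 * \<alpha> + 1) (2 * \<alpha> + 1)) *
      (\<integral>\<^sup>+u\<in>{0<..}. ennreal (u powr (4 * \<alpha> + 1) * (cmod (h u))\<^sup>2) \<partial>lborel)"
proof -
  have "(\<integral>\<^sup>+t. \<integral>\<^sup>+\<tau>. ennreal ((cmod (hankel_kernel t \<tau>))\<^sup>2) \<partial>half_line \<partial>half_line)
      = (\<integral>\<^sup>+t. \<integral>\<^sup>+\<tau>. ennreal (t powr (2 * \<alpha>) * \<tau> powr (2 * \<alpha>)) * ennreal ((cmod (h_ext (t + \<tau>)))\<^sup>2)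
          \<partial>half_line \<partial>half_line)"
  proof (intro nn_integral_cong)
    fix t \<tau> assume "t \<in> space half_line" "\<tau> \<in> space half_line"
    then have "(cmod (hankel_kernel t \<tau>))\<^sup>2
        = (t powr (2 * \<alpha>) * \<tau> powr (2 * \<alpha>)) * (cmod (h_ext (t + \<tau>)))\<^sup>2"
      by (simp add: hankel_kernel_ext norm_mult power_mult_distrib powr_power mult_ac)
    then show "ennreal ((cmod (hankel_kernel t \<tau>))\<^sup>2)
        = ennreal (t powr (2 * \<alpha>) * \<tau> powr (2 * \<alpha>)) * ennreal ((cmod (h_ext (t + \<tau>)))\<^sup>2)"
      by (simp add: ennreal_mult)
  qed
  also have "\<dots> = ennreal (Beta (2 * \<alpha> + 1) (2 * \<alpha> + 1)) *
      (\<integral>\<^sup>+u. ennreal (u powr (2 * (2 * \<alpha>) + 1)) * ennreal ((cmod (h_ext u))\<^sup>2) * indicator {0<..} u \<partial>lborel)"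
    using \<alpha> by (intro nn_integral_hankel_kernel) auto
  also have "(\<integral>\<^sup>+u. ennreal (u powr (2 * (2 * \<alpha>) + 1)) * ennreal ((cmod (h_ext u))\<^sup>2) * indicator {0<..} u \<partial>lborel)
      = (\<integral>\<^sup>+u\<in>{0<..}. ennreal (u powr (4 * \<alpha> + 1) * (cmod (h u))\<^sup>2) \<partial>lborel)"
    by (intro nn_integral_cong) (auto simp: indicator_def h_ext_def ennreal_mult)
  finally show ?thesis .
qed

lemma hankel_kernel_sq_integral_finite_iff:
  "(\<integral>\<^sup>+t. \<integral>\<^sup>+\<tau>. ennreal ((cmod (hankel_kernel t \<tau>))\<^sup>2) \<partial>half_line \<partial>half_line) < \<infinity>
    \<longleftrightarrow> (\<integral>\<^sup>+u\<in>{0<..}. ennreal (u powr (4 * \<alpha> + 1) * (cmod (h u))\<^sup>2) \<partial>lborel) < \<infinity>"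
proof -
  have "Beta (2 * \<alpha> + 1) (2 * \<alpha> + 1) > 0"
    using \<alpha> by (simp add: Beta_def Gamma_real_pos)
  then show ?thesis
    unfolding hankel_kernel_sq_integral by (auto simp: ennreal_mult_less_top)
qed

lemma weighted_hankel_eq:
  "weighted_hankel h w u t = (LINT \<tau>|half_line. hankel_kernel t \<tau> * u \<tau>)"
  by (simp add: weighted_hankel_def hankel_kernel_def)

text \<open>The operator is tested on \<open>u\<^sub>q = cnj (v\<^sub>q)\<close>, where \<open>v\<^sub>q \<tau> = h (q + \<tau>) w \<tau>\<close> is cut off to a
  compact interval; letting \<open>q\<close> run through the rationals keeps the exceptional null sets under
  control, and \<open>q \<rightarrow> t\<close> recovers the kernel at \<open>t\<close>.\<close>

definition cut_section :: "nat \<Rightarrow> real \<Rightarrow> real \<Rightarrow> complex" where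
  "cut_section n q \<tau> = indicator {1 / Suc n .. Suc n} \<tau> * (h (q + \<tau>) * complex_of_real (w \<tau>))"

text \<open>For q in [a, b] and \<tau> in the cut-off interval, both \<open>h (q + \<tau>)\<close>
  and the power of \<tau> are values of continuous functions on fixed compact sets. The bound is
  uniform in q, as dominated convergence for q \<rightarrow> t requires.\<close>

lemma cut_section_bound:
  assumes "0 < a"
  obtains C where "\<And>q \<tau>. a \<le> q \<Longrightarrow> q \<le> b \<Longrightarrow>
    cmod (cut_section n q \<tau>) \<le> cmod (C * indicator {1 / Suc n .. Suc n} \<tau>)"
proof -
  have "continuous_on {a .. b + Suc n} h"
    by (rule continuous_on_subset[OF cont]) (use assms in auto)
  then have "bounded (h ` {a .. b + Suc n})"
    by (intro compact_imp_bounded compact_continuous_image) auto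
  then obtain A where A: "\<forall>x\<in>{a .. b + Suc n}. cmod (h x) \<le> A" by (auto simp: bounded_iff)
  have "continuous_on {1 / Suc n .. Suc n} (\<lambda>\<tau>. \<tau> powr \<alpha>)"
    by (intro continuous_intros) (auto simp: field_simps)
  then have "bounded ((\<lambda>\<tau>. \<tau> powr \<alpha>) ` {1 / Suc n .. Suc n})"
    by (intro compact_imp_bounded compact_continuous_image) auto
  then obtain B where B: "\<forall>x\<in>{1 / Suc n .. Suc n}. x powr \<alpha> \<le> B" by (auto simp: bounded_iff)
  show ?thesis
  proof (rule that)
    fix q \<tau> :: real assume q: "a \<le> q" "q \<le> b"
    show "cmod (cut_section n q \<tau>) \<le> cmod (complex_of_real (A * B) * indicator {1 / Suc n .. Suc n} \<tau>)"
    proof (cases "\<tau> \<in> {1 / Suc n .. Suc n}")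
      case True
      have \<tau>: "\<tau> > 0" using True by (auto intro: less_le_trans[of 0 "1 / Suc n"])
      have "cmod (h (q + \<tau>)) * \<tau> powr \<alpha> \<le> A * B"
      proof (rule mult_mono)
        show hA: "cmod (h (q + \<tau>)) \<le> A" using A q \<tau> True by auto
        show "0 \<le> A" by (rule order_trans[OF norm_ge_zero hA])
        show "\<tau> powr \<alpha> \<le> B" using B True by auto
      qed auto
      then have "cmod (h (q + \<tau>)) * \<tau> powr \<alpha> \<le> \<bar>A * B\<bar>" by simp
      then show ?thesis using True \<tau> by (simp add: cut_section_def norm_mult w flip: abs_mult)
    qed (simp add: cut_section_def)
  qed
qed

lemma cut_section_measurable [measurable]:
  assumes "q > 0"
  shows "cut_section n q \<in> borel_measurable half_line"
proof -
  have "(\<lambda>\<tau>. indicator {1 / Suc n .. Suc n} \<tau> * (h_ext (q + \<tau>) * complex_of_real (\<tau> powr \<alpha>)))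
      \<in> borel_measurable half_line"
    by (intro borel_measurable_half_line) measurable
  moreover have "cut_section n q \<tau>
      = indicator {1 / Suc n .. Suc n} \<tau> * (h_ext (q + \<tau>) * complex_of_real (\<tau> powr \<alpha>))"
    if "\<tau> \<in> space half_line" for \<tau>
    using that assms by (simp add: cut_section_def h_ext_def w)
  ultimately show ?thesis by (subst measurable_cong)
qed

lemma L2_indicator_Icc: "(\<lambda>x. C * indicator {a..b::real} x :: complex) \<in> L2 half_line"
proof -
  have "(\<lambda>x. indicator {a..b} x :: complex) \<in> L2 half_line"
  proof (subst L2_iff_nn_integral)
    show "(\<lambda>x. indicator {a..b} x :: complex) \<in> borel_measurable half_line"
      by (intro borel_measurable_half_line) measurable
    have "(\<integral>\<^sup>+x. ennreal ((cmod (indicator {a..b} x))\<^sup>2) \<partial>half_line) \<le> (\<integral>\<^sup>+x. indicator {a..b} x \<partial>lborel)"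
      unfolding nn_integral_half_line by (intro nn_integral_mono) (auto simp: indicator_def)
    also have "\<dots> < \<infinity>" by (simp add: emeasure_lborel_Icc_eq)
    finally show "(\<integral>\<^sup>+x. ennreal ((cmod (indicator {a..b} x))\<^sup>2) \<partial>half_line) < \<infinity>" .
  qed
  then show ?thesis by (rule L2_scale)
qed

lemma cut_section_L2:
  assumes "q > 0"
  shows "cut_section n q \<in> L2 half_line"
proof -
  obtain C where "\<And>q' \<tau>. q \<le> q' \<Longrightarrow> q' \<le> q \<Longrightarrow>
      cmod (cut_section n q' \<tau>) \<le> cmod (C * indicator {1 / Suc n .. Suc n} \<tau>)"
    using cut_section_bound[OF assms, of q n] by blast
  then show ?thesis
    by (intro L2_bound[OF L2_indicator_Icc cut_section_measurable[OF assms]]) auto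
qed

text \<open>The indicator equals its square, so cutting off the test function also cuts off the
  kernel section, and the operator value becomes an inner product of two cut sections.\<close>

lemma weighted_hankel_cut_section:
  "weighted_hankel h w (\<lambda>\<tau>. cnj (cut_section n q \<tau>)) t
    = complex_of_real (w t) * L2_inner half_line (cut_section n t) (cut_section n q)"
proof -
  have "complex_of_real (w t) * h (t + \<tau>) * complex_of_real (w \<tau>) * cnj (cut_section n q \<tau>)
      = complex_of_real (w t) * (cut_section n t \<tau> * cnj (cut_section n q \<tau>))" for \<tau>
    by (simp add: cut_section_def indicator_def)
  then have "weighted_hankel h w (\<lambda>\<tau>. cnj (cut_section n q \<tau>)) t
      = (LINT \<tau>|half_line. complex_of_real (w t) * (cut_section n t \<tau> * cnj (cut_section n q \<tau>)))"
    unfolding weighted_hankel_def by presburger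
  then show ?thesis by (simp add: L2_inner_def)
qed

lemma cut_section_inner_tendsto:
  assumes t: "t > 0" and q: "q \<longlonglongrightarrow> t" and q_bds: "\<And>k. t / 2 \<le> q k \<and> q k \<le> 2 * t"
  shows "(\<lambda>k. L2_inner half_line (cut_section n t) (cut_section n (q k)))
      \<longlonglongrightarrow> L2_inner half_line (cut_section n t) (cut_section n t)"
    and "(\<lambda>k. LINT x|half_line. (cmod (cut_section n (q k) x))\<^sup>2)
      \<longlonglongrightarrow> (LINT x|half_line. (cmod (cut_section n t x))\<^sup>2)"
proof -
  let ?v = "cut_section n"
  have qpos: "q k > 0" for k using q_bds[of k] t by linarith
  note [measurable] = cut_section_measurable[OF t] cut_section_measurable[OF qpos]
  have t2: "t / 2 > 0" using t by simp
  obtain C where C: "\<And>q \<tau>. t / 2 \<le> q \<Longrightarrow> q \<le> 2 * t \<Longrightarrow>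
      cmod (?v q \<tau>) \<le> cmod (C * indicator {1 / Suc n .. Suc n} \<tau>)"
    using cut_section_bound[OF t2, of "2 * t" n] by blast
  let ?B = "\<lambda>\<tau>. (cmod (C * indicator {1 / Suc n .. Suc n} \<tau>))\<^sup>2"
  have B: "integrable half_line ?B" by (intro L2_integrable L2_indicator_Icc)
  have vt: "cmod (?v t \<tau>) \<le> cmod (C * indicator {1 / Suc n .. Suc n} \<tau>)"
    and vq: "cmod (?v (q k) \<tau>) \<le> cmod (C * indicator {1 / Suc n .. Suc n} \<tau>)" for \<tau> k
    using C t q_bds[of k] by auto
  have lim: "(\<lambda>k. ?v (q k) \<tau>) \<longlonglongrightarrow> ?v t \<tau>" if "\<tau> > 0" for \<tau>
  proof -
    have "(\<lambda>k. h (q k + \<tau>)) \<longlonglongrightarrow> h (t + \<tau>)"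
    proof (rule continuous_on_tendsto_compose[OF cont])
      show "(\<lambda>k. q k + \<tau>) \<longlonglongrightarrow> t + \<tau>" by (intro tendsto_intros q)
      show "t + \<tau> \<in> {0<..}" using t that by simp
      have "q k + \<tau> \<in> {0<..}" for k using qpos[of k] that by simp
      then show "\<forall>\<^sub>F k in sequentially. q k + \<tau> \<in> {0<..}" by (intro always_eventually allI)
    qed
    then show ?thesis unfolding cut_section_def by (intro tendsto_mult tendsto_const)
  qed
  show "(\<lambda>k. L2_inner half_line (?v t) (?v (q k))) \<longlonglongrightarrow> L2_inner half_line (?v t) (?v t)"
    unfolding L2_inner_def
  proof (rule integral_dominated_convergence[where w = ?B])
    show "AE \<tau> in half_line. (\<lambda>k. ?v t \<tau> * cnj (?v (q k) \<tau>)) \<longlonglongrightarrow> ?v t \<tau> * cnj (?v t \<tau>)"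
      by (intro AE_I2 tendsto_mult tendsto_const tendsto_cnj lim) auto
    show "AE \<tau> in half_line. norm (?v t \<tau> * cnj (?v (q k) \<tau>)) \<le> ?B \<tau>" for k
    proof (rule AE_I2)
      fix \<tau>
      let ?b = "cmod (C * indicator {1 / Suc n .. Suc n} \<tau>)"
      have "cmod (?v t \<tau>) * cmod (?v (q k) \<tau>) \<le> ?b * ?b" by (intro mult_mono vt vq) auto
      then show "norm (?v t \<tau> * cnj (?v (q k) \<tau>)) \<le> ?B \<tau>"
        by (simp only: norm_mult[of "?v t \<tau>" "cnj (?v (q k) \<tau>)"] complex_mod_cnj power2_eq_square)
    qed
  qed (use B in auto)
  show "(\<lambda>k. LINT x|half_line. (cmod (?v (q k) x))\<^sup>2) \<longlonglongrightarrow> (LINT x|half_line. (cmod (?v t x))\<^sup>2)"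
  proof (rule integral_dominated_convergence[where w = ?B])
    show "AE \<tau> in half_line. (\<lambda>k. (cmod (?v (q k) \<tau>))\<^sup>2) \<longlonglongrightarrow> (cmod (?v t \<tau>))\<^sup>2"
      by (intro AE_I2 tendsto_power tendsto_norm lim) auto
    show "AE \<tau> in half_line. norm ((cmod (?v (q k) \<tau>))\<^sup>2) \<le> ?B \<tau>" for k
      using power_mono[OF vq norm_ge_zero] by (intro AE_I2) simp
  qed (use B in auto)
qed

text \<open>Here t is a single point off the null set and \<open>G\<close> is a number. The limit q
  \<rightarrow> t gives the estimate on each cut-off, and monotone convergence in \<open>n\<close>
  removes the cut-off.\<close>

lemma weighted_hankel_section_bound:
  assumes G: "\<And>n q. q \<in> \<rat> \<Longrightarrow> q > 0 \<Longrightarrow>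
      ennreal ((cmod (weighted_hankel h w (\<lambda>\<tau>. cnj (cut_section n q \<tau>)) t))\<^sup>2)
        \<le> ennreal (2 * (LINT x|half_line. (cmod (cut_section n q x))\<^sup>2)) * G"
    and t: "t > 0"
  shows "(\<integral>\<^sup>+\<tau>. ennreal ((cmod (hankel_kernel t \<tau>))\<^sup>2) \<partial>half_line) \<le> 2 * G"
proof (cases "G = \<infinity>")
  case False
  define g where "g = enn2real G"
  have g: "G = ennreal g" "0 \<le> g" using False by (auto simp: g_def top.not_eq_extremum)
  define m where "m n = (LINT x|half_line. (cmod (cut_section n t x))\<^sup>2)" for n
  have m0: "0 \<le> m n" for n by (simp add: m_def)
  obtain q where q: "q \<longlonglongrightarrow> t" "\<And>k::nat. q k \<in> \<rat>" "\<And>k. t / 2 \<le> q k \<and> q k \<le> 2 * t"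
    using rational_approximation[OF t] by blast
  have qpos: "q k > 0" for k using q(3)[of k] t by linarith
  have bound: "(w t)\<^sup>2 * m n \<le> 2 * g" for n
  proof -
    let ?I = "\<lambda>s. L2_inner half_line (cut_section n t) (cut_section n s)"
    let ?N = "\<lambda>s. LINT x|half_line. (cmod (cut_section n s x))\<^sup>2"
    have "(w t)\<^sup>2 * (cmod (?I (q k)))\<^sup>2 \<le> 2 * ?N (q k) * g" for k
    proof -
      have "ennreal ((cmod (complex_of_real (w t) * ?I (q k)))\<^sup>2) \<le> ennreal (2 * ?N (q k)) * ennreal g"
        using G[OF q(2) qpos, of n k] unfolding weighted_hankel_cut_section g .
      then have "ennreal ((cmod (complex_of_real (w t) * ?I (q k)))\<^sup>2) \<le> ennreal (2 * ?N (q k) * g)"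
        using g by (simp flip: ennreal_mult)
      then show ?thesis
        using g by (simp add: norm_mult power_mult_distrib)
    qed
    then have "(w t)\<^sup>2 * (cmod (?I t))\<^sup>2 \<le> 2 * ?N t * g"
      using cut_section_inner_tendsto[OF t q(1,3), of n]
      by (intro LIMSEQ_le[of "\<lambda>k. (w t)\<^sup>2 * (cmod (?I (q k)))\<^sup>2" _ "\<lambda>k. 2 * ?N (q k) * g"]
          tendsto_mult tendsto_const tendsto_power tendsto_norm) auto
    \<comment> \<open>At q = t the inner product is \<open>m n\<close> itself, so its square stands
      on the left and its first power on the right; one factor cancels unless
      \<open>m n = 0\<close>, where the claim is trivial.\<close>
    then have "m n * ((w t)\<^sup>2 * m n) \<le> m n * (2 * g)"
      using m0[of n] unfolding L2_inner_self m_def[symmetric] by (simp add: power2_eq_square mult_ac)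
    then show ?thesis using m0[of n] g by (cases "m n = 0") auto
  qed
  \<comment> \<open>The last indicator is 1 on the half-line; it provides the limit at every real
    \<tau>, as the monotone convergence rule asks.\<close>
  define f where "f n \<tau> = ennreal ((cmod (hankel_kernel t \<tau>))\<^sup>2) * indicator {1 / Suc n .. Suc n} \<tau>
    * indicator {0<..} \<tau>" for n \<tau>
  have f_le: "(\<integral>\<^sup>+\<tau>. f n \<tau> \<partial>half_line) \<le> 2 * G" for n
  proof -
    have "(\<integral>\<^sup>+\<tau>. f n \<tau> \<partial>half_line)
        = (\<integral>\<^sup>+\<tau>. ennreal ((w t)\<^sup>2) * ennreal ((cmod (cut_section n t \<tau>))\<^sup>2) \<partial>half_line)"
      by (intro nn_integral_cong)
        (simp add: f_def cut_section_def hankel_kernel_def indicator_def norm_mult power_mult_distrib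
          ennreal_mult mult_ac)
    also have "\<dots> = ennreal ((w t)\<^sup>2) * ennreal (m n)"
      unfolding m_def using cut_section_measurable[OF t, of n]
      by (subst nn_integral_cmult) (auto simp: L2_nn_integral[OF cut_section_L2[OF t]])
    also have "\<dots> = ennreal ((w t)\<^sup>2 * m n)" using m0[of n] by (simp add: ennreal_mult)
    also have "\<dots> \<le> ennreal (2 * g)" by (intro ennreal_leI bound)
    also have "\<dots> = 2 * G" using g by (simp add: ennreal_mult)
    finally show ?thesis .
  qed
  have "(\<lambda>n. \<integral>\<^sup>+\<tau>. f n \<tau> \<partial>half_line)
      \<longlonglongrightarrow> (\<integral>\<^sup>+\<tau>. ennreal ((cmod (hankel_kernel t \<tau>))\<^sup>2) * indicator {0<..} \<tau> \<partial>half_line)"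
  proof (rule nn_integral_LIMSEQ)
    show "incseq f"
    proof (rule incseq_SucI, rule le_funI)
      fix n \<tau>
      have "1 / real (Suc (Suc n)) \<le> 1 / real (Suc n)" by (simp add: field_simps)
      then have "{1 / real (Suc n) .. real (Suc n)} \<subseteq> {1 / real (Suc (Suc n)) .. real (Suc (Suc n))}"
        by (intro atLeastatMost_subset_iff[THEN iffD2]) simp
      then have "indicator {1 / real (Suc n) .. real (Suc n)} \<tau>
          \<le> (indicator {1 / real (Suc (Suc n)) .. real (Suc (Suc n))} \<tau> :: ennreal)"
        by (auto simp: indicator_def simp del: of_nat_Suc)
      then show "f n \<tau> \<le> f (Suc n) \<tau>"
        unfolding f_def by (intro mult_right_mono mult_left_mono) auto
    qed
    show "f n \<in> borel_measurable half_line" for n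
    proof -
      have [measurable]: "(\<lambda>\<tau>::real. indicator A \<tau> :: ennreal) \<in> borel_measurable half_line"
        if "A \<in> sets borel" for A
        using that by (intro borel_measurable_half_line borel_measurable_indicator)
      show ?thesis unfolding f_def using t by measurable
    qed
    show "(\<lambda>n. f n \<tau>) \<longlonglongrightarrow> ennreal ((cmod (hankel_kernel t \<tau>))\<^sup>2) * indicator {0<..} \<tau>" for \<tau>
    proof (cases "\<tau> > 0")
      case True
      obtain N1 :: nat where N1: "1 / \<tau> \<le> real N1" using real_arch_simple by blast
      obtain N2 :: nat where N2: "\<tau> \<le> real N2" using real_arch_simple by blast
      have "f n \<tau> = ennreal ((cmod (hankel_kernel t \<tau>))\<^sup>2)" if "n \<ge> max N1 N2" for n
      proof -
        have "1 / \<tau> \<le> real (Suc n)" "\<tau> \<le> real (Suc n)" using N1 N2 that by linarith+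
        then have "1 / real (Suc n) \<le> \<tau>" using True by (simp add: field_simps)
        then show ?thesis using True \<open>\<tau> \<le> real (Suc n)\<close> by (simp add: f_def)
      qed
      then have "\<forall>\<^sub>F n in sequentially. f n \<tau> = ennreal ((cmod (hankel_kernel t \<tau>))\<^sup>2)"
        unfolding eventually_sequentially by blast
      then show ?thesis using True by (simp add: tendsto_eventually)
    qed (simp add: f_def)
  qed
  then have "(\<integral>\<^sup>+\<tau>. ennreal ((cmod (hankel_kernel t \<tau>))\<^sup>2) * indicator {0<..} \<tau> \<partial>half_line) \<le> 2 * G"
    by (rule LIMSEQ_le_const2) (use f_le in auto)
  moreover have "(\<integral>\<^sup>+\<tau>. ennreal ((cmod (hankel_kernel t \<tau>))\<^sup>2) * indicator {0<..} \<tau> \<partial>half_line)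
      = (\<integral>\<^sup>+\<tau>. ennreal ((cmod (hankel_kernel t \<tau>))\<^sup>2) \<partial>half_line)"
    by (intro nn_integral_cong) simp
  ultimately show ?thesis by simp
qed simp

lemma hilbert_schmidt_hankel_kernel_finite:
  assumes HS: "hilbert_schmidt_L2 half_line (weighted_hankel h w)"
  shows "(\<integral>\<^sup>+t. \<integral>\<^sup>+\<tau>. ennreal ((cmod (hankel_kernel t \<tau>))\<^sup>2) \<partial>half_line \<partial>half_line) < \<infinity>"
proof -
  obtain G :: "real \<Rightarrow> ennreal" where [measurable]: "G \<in> borel_measurable half_line"
    and G_fin: "(\<integral>\<^sup>+t. G t \<partial>half_line) < \<infinity>"
    and G: "\<And>u. u \<in> L2 half_line \<Longrightarrow> AE t in half_line. ennreal ((cmod (weighted_hankel h w u t))\<^sup>2)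
        \<le> ennreal (2 * (LINT x|half_line. (cmod (u x))\<^sup>2)) * G t"
    using hilbert_schmidt_pointwise_bound[OF HS] by blast
  define Q where "Q = \<rat> \<inter> {0::real<..}"
  have "countable Q" unfolding Q_def using countable_rat by blast
  moreover have "AE t in half_line.
      ennreal ((cmod (weighted_hankel h w (\<lambda>\<tau>. cnj (cut_section n q \<tau>)) t))\<^sup>2)
        \<le> ennreal (2 * (LINT x|half_line. (cmod (cut_section n q x))\<^sup>2)) * G t" if "q \<in> Q" for n q
    using G[OF L2_cnj[OF cut_section_L2[of q n]]] that by (simp add: Q_def)
  ultimately have "AE t in half_line. \<forall>n. \<forall>q\<in>Q.
      ennreal ((cmod (weighted_hankel h w (\<lambda>\<tau>. cnj (cut_section n q \<tau>)) t))\<^sup>2)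
        \<le> ennreal (2 * (LINT x|half_line. (cmod (cut_section n q x))\<^sup>2)) * G t"
    by (simp add: AE_all_countable AE_ball_countable)
  then have "AE t in half_line.
      (\<integral>\<^sup>+\<tau>. ennreal ((cmod (hankel_kernel t \<tau>))\<^sup>2) \<partial>half_line) \<le> 2 * G t"
  proof (rule AE_mp, intro AE_I2 impI)
    fix t assume "t \<in> space half_line" and "\<forall>n. \<forall>q\<in>Q.
      ennreal ((cmod (weighted_hankel h w (\<lambda>\<tau>. cnj (cut_section n q \<tau>)) t))\<^sup>2)
        \<le> ennreal (2 * (LINT x|half_line. (cmod (cut_section n q x))\<^sup>2)) * G t"
    then show "(\<integral>\<^sup>+\<tau>. ennreal ((cmod (hankel_kernel t \<tau>))\<^sup>2) \<partial>half_line) \<le> 2 * G t"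
      by (intro weighted_hankel_section_bound) (auto simp: Q_def)
  qed
  then have "(\<integral>\<^sup>+t. \<integral>\<^sup>+\<tau>. ennreal ((cmod (hankel_kernel t \<tau>))\<^sup>2) \<partial>half_line \<partial>half_line)
      \<le> (\<integral>\<^sup>+t. 2 * G t \<partial>half_line)"
    by (rule nn_integral_mono_AE)
  also have "\<dots> < \<infinity>"
    using G_fin by (simp add: nn_integral_cmult ennreal_mult_less_top)
  finally show ?thesis .
qed

lemma weighted_hankel_hilbert_schmidt_iff:
  "weighted_hankel_hilbert_schmidt h w \<longleftrightarrow>
    (\<integral>\<^sup>+u\<in>{0<..}. ennreal (u powr (4 * \<alpha> + 1) * (cmod (h u))\<^sup>2) \<partial>lborel) < \<infinity>"
  unfolding hankel_kernel_sq_integral_finite_iff[symmetric]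
proof
  assume "weighted_hankel_hilbert_schmidt h w"
  then show "(\<integral>\<^sup>+t. \<integral>\<^sup>+\<tau>. ennreal ((cmod (hankel_kernel t \<tau>))\<^sup>2) \<partial>half_line \<partial>half_line) < \<infinity>"
    unfolding weighted_hankel_hilbert_schmidt_def
    by (intro hilbert_schmidt_hankel_kernel_finite) simp
next
  assume fin: "(\<integral>\<^sup>+t. \<integral>\<^sup>+\<tau>. ennreal ((cmod (hankel_kernel t \<tau>))\<^sup>2) \<partial>half_line \<partial>half_line) < \<infinity>"
  obtain e where e: "orthonormal_basis half_line e" using orthonormal_basis_half_line by blast
  have "weighted_hankel h w = (\<lambda>u t. LINT \<tau>|half_line. hankel_kernel t \<tau> * u \<tau>)"
    by (simp add: weighted_hankel_eq fun_eq_iff)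
  then show "weighted_hankel_hilbert_schmidt h w"
    using kernel_L2_hilbert_schmidt[OF sigma_finite_half_line hankel_kernel_measurable fin e]
    unfolding weighted_hankel_hilbert_schmidt_def weighted_hankel_defined_def
    by (simp add: hankel_kernel_def)
qed

end


section \<open>Laplace transforms of measures on the half-plane\<close>

lemma neg_reals_eq: "neg_reals = {p. Im p = 0 \<and> Re p < 0}"
  by (auto simp: neg_reals_def image_iff complex_eq_iff)

context
  fixes M :: "complex measure" and \<theta> :: "complex \<Rightarrow> complex" and h :: "real \<Rightarrow> complex"
  assumes polar: "polar_measure_on_left_half_plane M \<theta>"
    and fin: "\<And>t. t > 0 \<Longrightarrow> (\<integral>\<^sup>+p. ennreal (cmod (exp (complex_of_real t * p))) \<partial>M) < \<infinity>"
    and h: "\<And>t. t > 0 \<Longrightarrow> h t = (LINT p|M. exp (complex_of_real t * p) * \<theta> p)"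
begin

lemma space_polar: "space M = left_half_plane"
  using polar sets_eq_imp_space_eq[of M "restrict_space borel left_half_plane"]
  by (simp add: polar_measure_on_left_half_plane_def space_restrict_space)

lemma measurable_polarI: "f \<in> borel_measurable borel \<Longrightarrow> f \<in> borel_measurable M"
  using polar measurable_cong_sets[of M "restrict_space borel left_half_plane" borel borel]
  by (auto simp: polar_measure_on_left_half_plane_def intro: measurable_restrict_space1)

lemma theta_measurable [measurable]: "\<theta> \<in> borel_measurable M"
  using polar by (simp add: polar_measure_on_left_half_plane_def)

lemma norm_theta: "p \<in> space M \<Longrightarrow> cmod (\<theta> p) = 1"
  using polar by (simp add: polar_measure_on_left_half_plane_def space_polar)

lemma laplace_kernel_measurable: "(\<lambda>p. exp (complex_of_real t * p)) \<in> borel_measurable M"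
  by (intro measurable_polarI borel_measurable_continuous_onI continuous_intros)

lemma laplace_kernel_integrable:
  "t > 0 \<Longrightarrow> integrable M (\<lambda>p. exp (complex_of_real t * p))"
  using laplace_kernel_measurable fin by (simp add: integrable_iff_bounded)

text \<open>Since Re p < 0, the kernel decreases in modulus as the parameter grows, so parameters
  above t / 2 are dominated by the integrable kernel at t / 2.\<close>

lemma laplace_transform_continuous: "continuous_on {0<..} h"
proof (rule continuous_on_sequentiallyI)
  fix q :: "nat \<Rightarrow> real" and t :: real
  assume q: "\<forall>n. q n \<in> {0<..}" and t: "t \<in> {0<..}" and lim: "q \<longlonglongrightarrow> t"
  note [measurable] = laplace_kernel_measurable
  have "\<forall>\<^sub>F n in sequentially. t / 2 < q n"
    using t by (intro order_tendstoD[OF lim]) auto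
  then obtain N where N: "\<And>n. n \<ge> N \<Longrightarrow> t / 2 < q n" by (auto simp: eventually_sequentially)
  \<comment> \<open>The index is shifted by \<open>N\<close> because the domination holds only from
    there on.\<close>
  have "(\<lambda>n. LINT p|M. exp (complex_of_real (q (n + N)) * p) * \<theta> p)
      \<longlonglongrightarrow> (LINT p|M. exp (complex_of_real t * p) * \<theta> p)"
  proof (rule integral_dominated_convergence
      [where w = "\<lambda>p. cmod (exp (complex_of_real (t / 2) * p))"])
    show "integrable M (\<lambda>p. cmod (exp (complex_of_real (t / 2) * p)))"
      by (intro integrable_norm laplace_kernel_integrable) (use t in auto)
    show "AE p in M. (\<lambda>n. exp (complex_of_real (q (n + N)) * p) * \<theta> p)
        \<longlonglongrightarrow> exp (complex_of_real t * p) * \<theta> p"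
      by (intro AE_I2 tendsto_intros LIMSEQ_ignore_initial_segment lim)
    show "AE p in M. norm (exp (complex_of_real (q (n + N)) * p) * \<theta> p)
        \<le> cmod (exp (complex_of_real (t / 2) * p))" for n
    proof (rule AE_I2)
      fix p assume p: "p \<in> space M"
      then have "Re p < 0" by (simp add: space_polar left_half_plane_def)
      then have "q (n + N) * Re p \<le> t / 2 * Re p"
        using N[of "n + N"] by (intro mult_right_mono_neg) auto
      then show "norm (exp (complex_of_real (q (n + N)) * p) * \<theta> p)
          \<le> cmod (exp (complex_of_real (t / 2) * p))"
        using norm_theta[OF p] by (simp add: norm_mult)
    qed
  qed measurable
  then have "(\<lambda>n. h (q (n + N))) \<longlonglongrightarrow> h t" using q t by (simp add: h)
  then show "(\<lambda>n. h (q n)) \<longlonglongrightarrow> h t" by (rule LIMSEQ_offset)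
qed

text \<open>On the negative reals the kernel is real and positive and \<open>\<theta>\<close> is 1
  almost everywhere, so no cancellation occurs. The extended-valued form prepares Tonelli.\<close>

lemma norm_laplace_transform_positive:
  assumes pos: "positive_polar M \<theta>" and supp: "supported_on_neg_reals M" and t: "t > 0"
  shows "ennreal (cmod (h t)) = (\<integral>\<^sup>+p. ennreal (exp (t * Re p)) \<partial>M)"
proof -
  note [measurable] = laplace_kernel_measurable
  have int: "integrable M (\<lambda>p. exp (t * Re p))"
    using integrable_norm[OF laplace_kernel_integrable[OF t]] by simp
  have [measurable]: "(\<lambda>p. complex_of_real (exp (t * Re p))) \<in> borel_measurable M"
    by (intro measurable_polarI) measurable
  have "h t = (LINT p|M. complex_of_real (exp (t * Re p)))"
    unfolding h[OF t]
  proof (rule integral_cong_AE)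
    show "AE p in M. exp (complex_of_real t * p) * \<theta> p = complex_of_real (exp (t * Re p))"
      using pos[unfolded positive_polar_def] supp[unfolded supported_on_neg_reals_def]
    proof eventually_elim
      case (elim p)
      then have "p = complex_of_real (Re p)" by (auto simp: neg_reals_eq complex_eq_iff)
      then have "complex_of_real t * p = complex_of_real (t * Re p)" by (metis of_real_mult)
      then show ?case using elim(1) by (simp only: exp_of_real mult_1_right)
    qed
  qed measurable
  then have "h t = complex_of_real (LINT p|M. exp (t * Re p))"
    by (simp only: integral_complex_of_real)
  then have "cmod (h t) = (LINT p|M. exp (t * Re p))"
    by (simp only: norm_of_real) (simp add: Bochner_Integration.integral_nonneg)
  then show ?thesis using nn_integral_eq_integral[OF int] by simp
qed

lemma weighted_sq_integral_eq_energy: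
  assumes pos: "positive_polar M \<theta>" and supp: "supported_on_neg_reals M" and a: "a > 0"
  shows "(\<integral>\<^sup>+u\<in>{0<..}. ennreal (u powr (a - 1) * (cmod (h u))\<^sup>2) \<partial>lborel)
    = ennreal (Gamma a) *
      (\<integral>\<^sup>+y\<in>neg_reals. (\<integral>\<^sup>+x\<in>neg_reals. ennreal (1 / cmod (x + y) powr a) \<partial>M) \<partial>M)"
proof -
  interpret sigma_finite_measure M
    using polar by (simp add: polar_measure_on_left_half_plane_def)
  interpret pair_sigma_finite M lborel
    by (intro pair_sigma_finite.intro sigma_finite_measure_axioms sigma_finite_lborel)
  have [measurable]: "Re \<in> borel_measurable M" "(\<lambda>p. p) \<in> borel_measurable M"
    "neg_reals \<in> sets M"
  proof -
    show "Re \<in> borel_measurable M" "(\<lambda>p. p) \<in> borel_measurable M"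
      by (intro measurable_polarI; measurable)+
    have "neg_reals \<in> sets borel" unfolding neg_reals_eq by measurable
    moreover have "neg_reals \<subseteq> left_half_plane" by (auto simp: neg_reals_eq left_half_plane_def)
    moreover have "sets M = sets (restrict_space borel left_half_plane)"
      using polar by (simp add: polar_measure_on_left_half_plane_def)
    ultimately show "neg_reals \<in> sets M" by (auto simp: sets_restrict_space)
  qed
  \<comment> \<open>Restricting to \<open>neg_reals\<close> changes nothing up to a null set and
    makes x + y a negative real pointwise in the innermost integral.\<close>
  define E where "E u p = ennreal (exp (u * Re p)) * indicator neg_reals p" for u p
  define k where "k u = ennreal (u powr (a - 1)) * indicator {0<..} u" for u
  have [measurable]: "k \<in> borel_measurable borel" unfolding k_def by measurable
  have [measurable]: "(\<lambda>(u, p). E u p) \<in> borel_measurable (borel \<Otimes>\<^sub>M M)"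
    unfolding E_def by measurable
  have hE: "ennreal (cmod (h u)) = (\<integral>\<^sup>+p. E u p \<partial>M)" if "u > 0" for u
    unfolding norm_laplace_transform_positive[OF pos supp that] E_def
    by (rule nn_integral_cong_AE) (use supp in \<open>auto simp: supported_on_neg_reals_def\<close>)
  have "(\<integral>\<^sup>+u\<in>{0<..}. ennreal (u powr (a - 1) * (cmod (h u))\<^sup>2) \<partial>lborel)
      = (\<integral>\<^sup>+u. \<integral>\<^sup>+y. \<integral>\<^sup>+x. k u * E u x * E u y \<partial>M \<partial>M \<partial>lborel)"
  proof (rule nn_integral_cong)
    fix u :: real
    have "ennreal (u powr (a - 1) * (cmod (h u))\<^sup>2) * indicator {0<..} u
        = k u * (\<integral>\<^sup>+x. E u x \<partial>M) * (\<integral>\<^sup>+y. E u y \<partial>M)"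
    proof (cases "u > 0")
      case True
      then show ?thesis
        by (simp add: k_def hE[symmetric] power2_eq_square ennreal_mult mult_ac)
    qed (simp add: k_def)
    also have "\<dots> = (\<integral>\<^sup>+y. \<integral>\<^sup>+x. k u * E u x * E u y \<partial>M \<partial>M)"
      by (simp add: nn_integral_cmult nn_integral_multc)
    finally show "ennreal (u powr (a - 1) * (cmod (h u))\<^sup>2) * indicator {0<..} u
        = (\<integral>\<^sup>+y. \<integral>\<^sup>+x. k u * E u x * E u y \<partial>M \<partial>M)" .
  qed
  \<comment> \<open>Two exchanges bring the u-integral inside, first past y and then past x.\<close>
  also have "\<dots> = (\<integral>\<^sup>+y. \<integral>\<^sup>+u. \<integral>\<^sup>+x. k u * E u x * E u y \<partial>M \<partial>lborel \<partial>M)"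
    by (rule Fubini'[where f = "\<lambda>y u. \<integral>\<^sup>+x. k u * E u x * E u y \<partial>M"]) measurable
  also have "\<dots> = (\<integral>\<^sup>+y. \<integral>\<^sup>+x. \<integral>\<^sup>+u. k u * E u x * E u y \<partial>lborel \<partial>M \<partial>M)"
    by (intro nn_integral_cong Fubini'[where f = "\<lambda>x u. k u * E u x * E u _"]) measurable
  also have "\<dots> = (\<integral>\<^sup>+y. \<integral>\<^sup>+x. ennreal (Gamma a) *
      (ennreal (1 / cmod (x + y) powr a) * indicator neg_reals x * indicator neg_reals y) \<partial>M \<partial>M)"
  proof (intro nn_integral_cong)
    fix y x
    show "(\<integral>\<^sup>+u. k u * E u x * E u y \<partial>lborel) = ennreal (Gamma a) *
      (ennreal (1 / cmod (x + y) powr a) * indicator neg_reals x * indicator neg_reals y)"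
    proof (cases "x \<in> neg_reals \<and> y \<in> neg_reals")
      case True
      \<comment> \<open>The decay rate in u, which is also \<open>cmod (x + y)\<close>; this is how
        the modulus in the energy arises from the Gamma integral.\<close>
      define c where "c = - (Re x + Re y)"
      have c: "c > 0" using True by (auto simp: c_def neg_reals_eq)
      have "x + y = complex_of_real (- c)"
        using True by (auto simp: c_def neg_reals_eq complex_eq_iff)
      then have "cmod (x + y) = c" using c by (simp only: norm_of_real)
      moreover have "k u * E u x * E u y
          = ennreal (u powr (a - 1) * exp (- (c * u))) * indicator {0<..} u" for u
      proof -
        have "exp (- (c * u)) = exp (u * Re x) * exp (u * Re y)"
          by (simp add: c_def algebra_simps flip: exp_add)
        then show ?thesis
          using True by (simp only:) (simp add: k_def E_def ennreal_mult mult_ac)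
      qed
      ultimately show ?thesis using True nn_integral_Gamma_scaled[OF a c] by simp
    qed (auto simp: E_def)
  qed
  also have "\<dots> = ennreal (Gamma a) *
      (\<integral>\<^sup>+y\<in>neg_reals. (\<integral>\<^sup>+x\<in>neg_reals. ennreal (1 / cmod (x + y) powr a) \<partial>M) \<partial>M)"
    by (simp add: nn_integral_cmult nn_integral_multc)
  finally show ?thesis .
qed

end

theorem proposition2p5:
  fixes M :: "complex measure" and \<theta> :: "complex \<Rightarrow> complex"
    and h :: "real \<Rightarrow> complex" and w :: "real \<Rightarrow> real" and \<alpha> :: real
  assumes "polar_measure_on_left_half_plane M \<theta>"
    and "\<And>t. t > 0 \<Longrightarrow> (\<integral>\<^sup>+p. ennreal (cmod (exp (complex_of_real t * p))) \<partial>M) < \<infinity>"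
    and "\<And>t. t > 0 \<Longrightarrow> h t = (LINT p|M. exp (complex_of_real t * p) * \<theta> p)"
    and "\<And>t. t > 0 \<Longrightarrow> w t = t powr \<alpha>"
    and "\<alpha> > - 1 / 2"
  shows "(weighted_hankel_hilbert_schmidt h w \<longleftrightarrow>
            (\<integral>\<^sup>+u\<in>{0<..}. ennreal (u powr (4 * \<alpha> + 1) * (cmod (h u))\<^sup>2) \<partial>lborel) < \<infinity>)
       \<and> (positive_polar M \<theta> \<and> supported_on_neg_reals M \<longrightarrow>
            (weighted_hankel_hilbert_schmidt h w \<longleftrightarrow>
              (\<integral>\<^sup>+y\<in>neg_reals. (\<integral>\<^sup>+x\<in>neg_reals.
                 ennreal (1 / cmod (x + y) powr (4 * \<alpha> + 2)) \<partial>M) \<partial>M) < \<infinity>))"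
proof (intro conjI impI)
  show HS: "weighted_hankel_hilbert_schmidt h w \<longleftrightarrow>
      (\<integral>\<^sup>+u\<in>{0<..}. ennreal (u powr (4 * \<alpha> + 1) * (cmod (h u))\<^sup>2) \<partial>lborel) < \<infinity>"
    by (rule weighted_hankel_hilbert_schmidt_iff[OF laplace_transform_continuous[OF assms(1-3)] assms(4,5)])
  assume "positive_polar M \<theta> \<and> supported_on_neg_reals M"
  moreover have "4 * \<alpha> + 2 > 0" using assms(5) by simp
  ultimately have "(\<integral>\<^sup>+u\<in>{0<..}. ennreal (u powr (4 * \<alpha> + 1) * (cmod (h u))\<^sup>2) \<partial>lborel)
      = ennreal (Gamma (4 * \<alpha> + 2)) * (\<integral>\<^sup>+y\<in>neg_reals. (\<integral>\<^sup>+x\<in>neg_reals.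
          ennreal (1 / cmod (x + y) powr (4 * \<alpha> + 2)) \<partial>M) \<partial>M)"
    using weighted_sq_integral_eq_energy[OF assms(1-3), of "4 * \<alpha> + 2"] by (simp add: algebra_simps)
  \<comment> \<open>Positivity matters because \<open>0 * \<infinity> = 0\<close> in the extended
    reals: a zero factor would hide an infinite energy.\<close>
  moreover have "Gamma (4 * \<alpha> + 2) > 0" using assms(5) by (intro Gamma_real_pos) simp
  ultimately show "weighted_hankel_hilbert_schmidt h w \<longleftrightarrow>
      (\<integral>\<^sup>+y\<in>neg_reals. (\<integral>\<^sup>+x\<in>neg_reals.
         ennreal (1 / cmod (x + y) powr (4 * \<alpha> + 2)) \<partial>M) \<partial>M) < \<infinity>"
    unfolding HS by (auto simp: ennreal_mult_less_top)
qed

end
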